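(* Let $x \in (0,1)$ be irrational. Suppose that for every integer $k\ge 1$ and every string $s$ of $k$ positive integers, $$\lim_{n\to\infty} \frac{|\{i \in \mathbb{Z} \mid 0 \leq i \leq n,\ T^{i}x \in C_s\}|}{n} = \gamma(C_s).$$ Then for every nonempty finite string $t$ of positive integers, with $m$ denoting the length of $t$, $$\lim_{n\to\infty} \frac{|\{i \in \mathbb{Z} \mid 0 \leq i \leq \tfrac{n}{m},\ T^{mi}x \in C_t\}|}{n/m} = \gamma(C_t).$$
   Context: Every irrational $x\in(0,1)$ has a unique continued fraction expansion $x=[0;a_1,a_2,\dots]$ with $a_i$ positive integers. For a finite string $w=w_1\dots w_m$ of positive integers, the cylinder $C_w$ is the set of $x\in[0,1]$ whose continued fraction expansion $[0;a_1,a_2,\dots]$ has $w$ as a prefix, i.e. $a_i=w_i$ for $1\le i\le m$. $\gamma$ is the Gauss measure on Borel subsets of $(0,1)$: $\gamma(A)=\frac{1}{\ln 2}\int_A \frac{1}{1+x}\,dx$. $T$ is the Gauss map $T(x)=\frac1x-\lfloor\frac1x\rfloor$, which acts on expansions as the left shift $T([0;a_1,a_2,\dots])=[0;a_2,a_3,\dots]$. The variable $n$ ranges over positive integers. *)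

theory Defs
  imports "HOL-Analysis.Analysis"
begin

definition gauss_map :: "real \<Rightarrow> real"
  where "gauss_map x = 1 / x - of_int \<lfloor>1 / x\<rfloor>"

text \<open>The finite continued fraction \<open>[0; a\<^sub>1, \<dots>, a\<^sub>m]\<close>, given by its list of digits.\<close>

fun cf_value :: "nat list \<Rightarrow> real"
  where
    "cf_value [] = 0"
  | "cf_value (a # as) = 1 / (real a + cf_value as)"

text \<open>\<open>x = [0; a 0, a 1, \<dots>]\<close>: the digits are indexed from 0, so \<open>a i\<close> is the digit
  \<open>a\<^bsub>i+1\<^esub>\<close> of the usual numbering. Only infinite expansions are considered.\<close>

definition cf_expansion :: "real \<Rightarrow> (nat \<Rightarrow> nat) \<Rightarrow> bool"
  where "cf_expansion x a \<longleftrightarrow>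
    (\<forall>i. 0 < a i) \<and> (\<lambda>n. cf_value (map a [0..<n])) \<longlonglongrightarrow> x"

text \<open>Rational points have no infinite expansion, so a cylinder contains irrationals only.\<close>

definition cylinder :: "nat list \<Rightarrow> real set"
  where "cylinder w =
    {x \<in> {0..1}. \<exists>a. cf_expansion x a \<and> (\<forall>i<length w. a i = w ! i)}"

definition gauss_measure :: "real measure"
  where "gauss_measure =
    density (restrict_space lborel {0<..<1}) (\<lambda>x. ennreal (1 / ln 2 * (1 / (1 + x))))"

lemma sets_gauss_measure:
  "sets gauss_measure = {A. A \<in> sets borel \<and> A \<subseteq> {0<..<1}}"
  by (auto simp: gauss_measure_def sets_restrict_space_iff subset_iff)

lemma measure_gauss_measure:
  assumes "A \<in> sets borel" "A \<subseteq> {0<..<1}"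
  shows "measure gauss_measure A = 1 / ln 2 * (LINT x:A|lborel. 1 / (1 + x))"
proof -
  have A: "A \<in> sets (restrict_space lborel {0<..<1})"
    using assms by (simp add: sets_restrict_space_iff)
  have nonneg: "0 \<le> 1 / ln 2 * (indicator A x * (1 / (1 + x)))" for x :: real
    using assms(2) by (auto simp: indicator_def)
  have "emeasure gauss_measure A =
      (\<integral>\<^sup>+x. ennreal (1 / ln 2 * (1 / (1 + x))) * indicator A x \<partial>restrict_space lborel {0<..<1})"
    unfolding gauss_measure_def using A by (intro emeasure_density) (auto intro: measurable_restrict_space1)
  also have "\<dots> = (\<integral>\<^sup>+x. ennreal (1 / ln 2 * (1 / (1 + x))) * indicator A x * indicator {0<..<1} x \<partial>lborel)"
    by (rule nn_integral_restrict_space) auto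
  also have "\<dots> = (\<integral>\<^sup>+x. ennreal (1 / ln 2 * (indicator A x * (1 / (1 + x)))) \<partial>lborel)"
    using assms(2) by (intro nn_integral_cong) (auto simp: indicator_def)
  finally have "measure gauss_measure A =
      enn2real (\<integral>\<^sup>+x. ennreal (1 / ln 2 * (indicator A x * (1 / (1 + x)))) \<partial>lborel)"
    by (simp add: measure_def)
  also have "\<dots> = (LINT x|lborel. 1 / ln 2 * (indicator A x * (1 / (1 + x))))"
    using assms(1) by (intro integral_eq_nn_integral[symmetric] AE_I2 nonneg) auto
  finally show ?thesis
    unfolding set_lebesgue_integral_def real_scaleR_def integral_mult_right_zero .
qed

end

theory Submission
  imports Defs
begin

text \<open>
  Let \<open>\<chi> j\<close> indicate that \<open>t\<close> occurs at position \<open>j\<close> in the digit sequence of \<open>x\<close>, and let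
  \<open>\<gamma>\<close> be the Gauss measure. By Cauchy--Schwarz, the mean of \<open>\<chi> (m i) - \<gamma>(C\<^sub>t)\<close> over \<open>i < N\<close>
  is controlled by the mean over all \<open>j < m N\<close> of the square of
  \<open>(1/L) (\<Sum>l<L. \<chi> (j + m r l) - \<gamma>(C\<^sub>t))\<close>, since restricting a mean of nonnegative terms to the
  multiples of \<open>m\<close> costs only a factor \<open>m\<close>. Expanding the square leaves the frequencies of pairs of
  occurrences of \<open>t\<close> at distance \<open>m k\<close> with \<open>k \<ge> r\<close>. As \<open>m\<close> is the length of \<open>t\<close>, such a pair is
  an occurrence of some \<open>t u t\<close>, so up to words \<open>u\<close> with a large digit normality gives the
  frequency \<open>\<Sum>\<^sub>u \<gamma>(C\<^bsub>tut\<^esub>)\<close>, and it remains to see that this is at most \<open>\<gamma>(C\<^sub>t)\<^sup>2 + o(1)\<close>.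

  For that, \<open>\<gamma>\<close> is the average over \<open>s\<close>, itself distributed by \<open>\<gamma>\<close>, of the laws on \<open>[0, 1]\<close>
  with density \<open>(1 + s) / (1 + s y)\<^sup>2\<close>. Under the law with parameter \<open>s\<close> the first digit is \<open>a\<close> with
  probability \<open>(1 + s) / ((a + s) (a + s + 1))\<close>, and given this the Gauss map produces the law with
  parameter \<open>1 / (a + s)\<close>. The resulting Markov chain on \<open>s\<close> contracts Lipschitz constants by \<open>7/8\<close>.
\<close>

section \<open>Cylinders of continued fractions\<close>

text \<open>For w = w_1 ... w_m this is [0; w_1, ..., w_m + z], the inverse branch of the m-th
  iterate of the Gauss map that belongs to the digits \<open>w\<close>. Its values at 0 and 1 are
  the endpoints of the cylinder.\<close>

fun cf_branch :: "nat list \<Rightarrow> real \<Rightarrow> real" where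
  "cf_branch [] z = z"
| "cf_branch (a # w) z = 1 / (real a + cf_branch w z)"

lemma cf_value_eq_branch: "cf_value w = cf_branch w 0"
  by (induction w) auto

lemma cf_branch_unit:
  assumes "\<forall>d\<in>set w. d > 0" "z \<in> {0..1}"
  shows "cf_branch w z \<in> {0..1}"
  using assms
proof (induction w)
  case (Cons a w)
  then have "cf_branch w z \<in> {0..1}" "real a \<ge> 1" by auto
  then show ?case by (auto simp: field_simps)
qed auto

definition digit_prob :: "nat \<Rightarrow> real \<Rightarrow> real" where
  "digit_prob a s = (1 + s) / ((real a + s) * (real a + s + 1))"

fun word_prob :: "nat list \<Rightarrow> real \<Rightarrow> real" where
  "word_prob [] s = 1"
| "word_prob (a # w) s = digit_prob a s * word_prob w (1 / (real a + s))"

text \<open>The parameter of the law of the remaining digits after reading a word.\<close>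

fun word_state :: "nat list \<Rightarrow> real \<Rightarrow> real" where
  "word_state [] s = s"
| "word_state (a # w) s = word_state w (1 / (real a + s))"

text \<open>The distribution function of the density \<open>\<lambda>y. (1 + s) / (1 + s * y)\<^sup>2\<close> on \<open>[0, 1]\<close>.\<close>

definition density_cdf :: "real \<Rightarrow> real \<Rightarrow> real" where
  "density_cdf s y = y * (1 + s) / (1 + s * y)"

lemma state_step:
  assumes "a > (0::nat)" "s \<in> {0..1::real}"
  shows "1 / (real a + s) \<in> {0..1}"
  using assms by (auto simp: field_simps)

lemma word_state_unit:
  assumes "\<forall>d\<in>set w. d > 0" "s \<in> {0..1}"
  shows "word_state w s \<in> {0..1}"
  using assms
proof (induction w arbitrary: s)
  case (Cons a w)
  then show ?case using state_step[of a s] by simp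
qed auto

text \<open>The bound 1/2, uniform in the digit and the parameter, makes word probabilities, and
  with them the lengths of cylinders, decay geometrically.\<close>

lemma digit_prob_bounds:
  assumes "a > 0" "s \<in> {0..1}"
  shows "0 \<le> digit_prob a s" "digit_prob a s \<le> 1 / 2"
proof -
  have a: "real a \<ge> 1" using assms by simp
  show "0 \<le> digit_prob a s" using assms by (simp add: digit_prob_def)
  have "(1 + s) * 2 \<le> (real a + s) * (real a + s + 1)"
    by (rule mult_mono) (use a assms in auto)
  then show "digit_prob a s \<le> 1 / 2" using assms a
    by (simp add: digit_prob_def divide_simps mult_pos_pos)
qed

lemma word_prob_bounds:
  assumes "\<forall>d\<in>set w. d > 0" "s \<in> {0..1}"
  shows "0 \<le> word_prob w s \<and> word_prob w s \<le> (1 / 2) ^ length w"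
  using assms
proof (induction w arbitrary: s)
  case (Cons a w)
  then have IH: "0 \<le> word_prob w (1 / (real a + s)) \<and>
      word_prob w (1 / (real a + s)) \<le> (1 / 2) ^ length w"
    using state_step[of a s] by simp
  then have "digit_prob a s * word_prob w (1 / (real a + s)) \<le> 1 / 2 * (1 / 2) ^ length w"
    using digit_prob_bounds[of a s] Cons.prems by (intro mult_mono) auto
  then show ?case using digit_prob_bounds[of a s] Cons.prems IH by simp
qed auto

lemma word_prob_le_1:
  assumes "\<forall>d\<in>set w. d > 0" "s \<in> {0..1}"
  shows "word_prob w s \<le> 1"
  using word_prob_bounds[OF assms] power_le_one[of "1/2::real" "length w"] by linarith

lemma word_prob_append:
  "word_prob (v @ w) s = word_prob v s * word_prob w (word_state v s)"
  by (induction v arbitrary: s) auto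

text \<open>For z in [0, 1], the points between 1 / (a + z) and 1 / a are, up to endpoints, those
  with first digit \<open>a\<close> and remainder below \<open>z\<close>. Their mass is the
  probability of the digit times the distribution function of the remainder, whose law has parameter
  1 / (a + s).\<close>

lemma density_cdf_step:
  assumes "a > 0" "s \<ge> 0" "z \<ge> 0"
  shows "density_cdf s (1 / (real a + z))
    = density_cdf s (1 / real a) - digit_prob a s * density_cdf (1 / (real a + s)) z"
proof -
  have p: "real a > 0" "real a + z > 0" "real a + s > 0" "real a + z + s > 0" "real a + s + 1 > 0"
    using assms by auto
  have 1: "density_cdf s (1 / (real a + z)) = (1 + s) / (real a + z + s)"
    using p by (simp add: density_cdf_def divide_simps)
  have 2: "density_cdf s (1 / real a) = (1 + s) / (real a + s)"
    using p by (simp add: density_cdf_def divide_simps)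
  have "density_cdf (1 / (real a + s)) z = z * (real a + s + 1) / (real a + z + s)"
    using p by (simp add: density_cdf_def divide_simps)
  then have 3: "digit_prob a s * density_cdf (1 / (real a + s)) z
      = (1 + s) * z / ((real a + s) * (real a + z + s))"
    using p by (simp add: digit_prob_def)
  show ?thesis unfolding 1 2 3 using p
    by (simp add: divide_simps) (simp add: algebra_simps)
qed

text \<open>Induction with \<open>density_cdf_step\<close>. Each digit reverses orientation, whence
  the alternating sign.\<close>

lemma density_cdf_branch:
  assumes "\<forall>d\<in>set w. d > 0" "s \<in> {0..1}" "z \<in> {0..1}"
  shows "density_cdf s (cf_branch w z) - density_cdf s (cf_branch w 0)
    = (-1) ^ length w * word_prob w s * density_cdf (word_state w s) z"
  using assms
proof (induction w arbitrary: s)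
  case Nil
  then show ?case by (simp add: density_cdf_def)
next
  case (Cons a w)
  let ?s = "1 / (real a + s)"
  have b: "cf_branch w z \<in> {0..1}" "cf_branch w 0 \<in> {0..1}"
    using cf_branch_unit[of w] Cons.prems by auto
  have "density_cdf s (cf_branch (a # w) z) - density_cdf s (cf_branch (a # w) 0)
    = - digit_prob a s * (density_cdf ?s (cf_branch w z) - density_cdf ?s (cf_branch w 0))"
    using Cons.prems b by (simp add: density_cdf_step algebra_simps)
  then show ?case using Cons state_step[of a s] by simp
qed

text \<open>The law with parameter 0 is Lebesgue measure on [0, 1], so \<open>density_cdf 0\<close>
  is the identity and \<open>density_cdf_branch\<close> measures plain distances.\<close>

lemma cf_branch_diff:
  assumes "\<forall>d\<in>set w. d > 0" "z \<in> {0..1}"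
  shows "\<bar>cf_branch w z - cf_branch w 0\<bar> \<le> (1 / 2) ^ length w"
proof -
  have st: "word_state w 0 \<in> {0..1}" using word_state_unit[OF assms(1), of 0] by simp
  have "cf_branch w z - cf_branch w 0 = (-1) ^ length w * word_prob w 0 * density_cdf (word_state w 0) z"
    using density_cdf_branch[OF assms(1) _ assms(2), of 0] by (simp add: density_cdf_def)
  moreover have "0 \<le> density_cdf (word_state w 0) z" "density_cdf (word_state w 0) z \<le> 1"
    using st assms(2) add_pos_nonneg[of 1 "word_state w 0 * z"]
    by (auto simp: density_cdf_def algebra_simps mult_nonneg_nonneg)
  moreover have "0 \<le> word_prob w 0" "word_prob w 0 \<le> (1 / 2) ^ length w"
    using word_prob_bounds[OF assms(1), of 0] by auto
  ultimately show ?thesis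
    using mult_mono[of "word_prob w 0" "(1 / 2) ^ length w" "density_cdf (word_state w 0) z" 1]
    by (simp add: abs_mult)
qed

section \<open>Digits read off by the Gauss map, and infinite expansions\<close>

definition gauss_digit :: "real \<Rightarrow> nat" where
  "gauss_digit y = nat \<lfloor>1 / y\<rfloor>"

lemma gauss_step:
  assumes "y = 1 / (real a + z)" "0 \<le> z" "z < 1"
  shows "gauss_digit y = a" "gauss_map y = z"
proof -
  have "1 / y = real a + z" using assms by simp
  moreover from this have "\<lfloor>1 / y\<rfloor> = int a" using assms by linarith
  ultimately show "gauss_digit y = a" "gauss_map y = z"
    by (simp_all add: gauss_digit_def gauss_map_def)
qed

lemma irrational_gauss:
  assumes "y \<in> {0<..<1} - \<rat>"
  shows "gauss_digit y > 0" "gauss_map y \<in> {0<..<1} - \<rat>" "y = 1 / (real (gauss_digit y) + gauss_map y)"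
proof -
  have y: "y > 0" "y < 1" "y \<notin> \<rat>" using assms by auto
  have irr: "1 / y \<notin> \<rat>"
  proof
    assume "1 / y \<in> \<rat>"
    from Rats_inverse[OF this] show False using y(3) by simp
  qed
  have "1 / y > 1" using y by simp
  then have f: "\<lfloor>1 / y\<rfloor> \<ge> 1" by linarith
  then show "gauss_digit y > 0" by (simp add: gauss_digit_def)
  have d: "real (gauss_digit y) = of_int \<lfloor>1 / y\<rfloor>"
    unfolding gauss_digit_def using f by (intro of_nat_nat) linarith
  have g: "gauss_map y = 1 / y - real (gauss_digit y)" by (simp add: gauss_map_def d)
  have "gauss_map y \<notin> \<rat>"
  proof
    assume "gauss_map y \<in> \<rat>"
    then have "gauss_map y + real (gauss_digit y) \<in> \<rat>" by (intro Rats_add) auto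
    then show False using irr g by simp
  qed
  moreover from this have "gauss_map y \<noteq> 0" by auto
  moreover have "0 \<le> gauss_map y" "gauss_map y < 1"
    unfolding gauss_map_def by linarith+
  ultimately show "gauss_map y \<in> {0<..<1} - \<rat>" by simp
  show "y = 1 / (real (gauss_digit y) + gauss_map y)" by (simp add: g)
qed

lemma irrational_gauss_iter:
  assumes "y \<in> {0<..<1} - \<rat>"
  shows "(gauss_map ^^ i) y \<in> {0<..<1} - \<rat>"
proof (induction i)
  case (Suc i)
  then show ?case using irrational_gauss(2) by simp
qed (use assms in simp)

lemma irrational_eq_branch:
  assumes "y \<in> {0<..<1} - \<rat>"
  shows "y = cf_branch (map (\<lambda>i. gauss_digit ((gauss_map ^^ i) y)) [0..<n]) ((gauss_map ^^ n) y)"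
  using assms
proof (induction n arbitrary: y)
  case (Suc n)
  have "map (\<lambda>i. gauss_digit ((gauss_map ^^ i) y)) [0..<Suc n]
    = gauss_digit y # map (\<lambda>i. gauss_digit ((gauss_map ^^ i) (gauss_map y))) [0..<n]"
    by (simp del: upt_Suc funpow.simps add: map_upt_Suc funpow_Suc_right)
  then show ?case
    using Suc.IH[OF irrational_gauss(2)[OF Suc.prems]] irrational_gauss(3)[OF Suc.prems]
    by (simp del: upt_Suc funpow.simps add: funpow_Suc_right)
qed simp

text \<open>The n-th convergent and \<open>y\<close> are values of one and the same branch, at 0 and
  at the n-th iterate of \<open>y\<close>, hence at most 2^(-n) apart.\<close>

lemma irrational_cf_expansion:
  assumes "y \<in> {0<..<1} - \<rat>"
  shows "cf_expansion y (\<lambda>i. gauss_digit ((gauss_map ^^ i) y))"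
proof -
  let ?a = "\<lambda>i. gauss_digit ((gauss_map ^^ i) y)"
  have pos: "0 < ?a i" for i
    using irrational_gauss(1) irrational_gauss_iter[OF assms] by blast
  have bound: "\<bar>cf_value (map ?a [0..<n]) - y\<bar> \<le> (1 / 2) ^ n" for n
  proof -
    have "(gauss_map ^^ n) y \<in> {0..1}" using irrational_gauss_iter[OF assms, of n] by auto
    then show ?thesis
      using cf_branch_diff[of "map ?a [0..<n]" "(gauss_map ^^ n) y"] pos
        irrational_eq_branch[OF assms, of n] by (simp add: cf_value_eq_branch abs_minus_commute)
  qed
  have null: "(\<lambda>n. (1 / 2 :: real) ^ n) \<longlonglongrightarrow> 0" by (rule LIMSEQ_power_zero) simp
  have "(\<lambda>n. cf_value (map ?a [0..<n]) - y) \<longlonglongrightarrow> 0"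
    by (rule Lim_null_comparison[OF always_eventually null]) (use bound in \<open>simp del: upt_Suc\<close>)
  then have "(\<lambda>n. cf_value (map ?a [0..<n])) \<longlonglongrightarrow> y" by (rule LIM_zero_cancel)
  then show ?thesis unfolding cf_expansion_def using pos by simp
qed

text \<open>All claims pass to the limit in v_(n+1) = 1 / (a_0 + u_n), where the u_n in [0, 1] are
  the convergents of the shifted digits. The limit gives only the weak bound at 1, which
  \<open>cf_expansion_step\<close> sharpens.\<close>

lemma cf_expansion_pos:
  assumes "cf_expansion y a"
  shows "0 < y" "y \<le> 1" "cf_expansion (1 / y - real (a 0)) (\<lambda>i. a (Suc i))"
proof -
  let ?v = "\<lambda>n. cf_value (map a [0..<n])"
  let ?u = "\<lambda>n. cf_value (map (\<lambda>i. a (Suc i)) [0..<n])"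
  have pos: "\<And>i. a i > 0" and lim: "?v \<longlonglongrightarrow> y" using assms by (auto simp: cf_expansion_def)
  have u: "?u n \<in> {0..1}" for n
    unfolding cf_value_eq_branch by (rule cf_branch_unit) (use pos in auto)
  have v: "?v (Suc n) = 1 / (real (a 0) + ?u n)" for n
    by (simp del: upt_Suc add: map_upt_Suc)
  have lim': "(\<lambda>n. ?v (Suc n)) \<longlonglongrightarrow> y" by (rule LIMSEQ_Suc[OF lim])
  have a0: "real (a 0) \<ge> 1" using pos[of 0] by simp
  have "1 / (real (a 0) + 1) \<le> ?v (Suc n)" for n
    unfolding v using u[of n] a0 by (intro divide_left_mono) auto
  then have "1 / (real (a 0) + 1) \<le> y" by (intro LIMSEQ_le_const[OF lim']) auto
  moreover have "0 < 1 / (real (a 0) + 1)" by simp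
  ultimately show y: "0 < y" by linarith
  have "?v (Suc n) \<le> 1" for n
    unfolding v using u[of n] a0 by auto
  then show "y \<le> 1" by (intro LIMSEQ_le_const2[OF lim']) auto
  have "?u n = 1 / ?v (Suc n) - real (a 0)" for n unfolding v by simp
  moreover have "(\<lambda>n. 1 / ?v (Suc n) - real (a 0)) \<longlonglongrightarrow> 1 / y - real (a 0)"
    using y by (intro tendsto_intros lim') auto
  ultimately show "cf_expansion (1 / y - real (a 0)) (\<lambda>i. a (Suc i))"
    using pos by (simp add: cf_expansion_def)
qed

lemma cf_expansion_step:
  assumes "cf_expansion y a"
  shows "y \<in> {0<..<1}" "gauss_digit y = a 0" "cf_expansion (gauss_map y) (\<lambda>i. a (Suc i))"
    "y = 1 / (real (a 0) + gauss_map y)"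
proof -
  define z where "z = 1 / y - real (a 0)"
  have y: "0 < y" "y \<le> 1" and z: "cf_expansion z (\<lambda>i. a (Suc i))"
    using cf_expansion_pos[OF assms] by (auto simp: z_def)
  \<comment> \<open>The remainder 1 / y - a_0 has an expansion itself and is therefore positive, so
    1 / y exceeds a_0, which is at least 1.\<close>
  have lt1: "y < 1" if c: "cf_expansion y a" for y a
  proof -
    have "0 < 1 / y - real (a 0)" using cf_expansion_pos(1)[OF cf_expansion_pos(3)[OF c]] .
    moreover have "real (a 0) \<ge> 1" using c by (simp add: cf_expansion_def Suc_leI)
    ultimately have "1 < 1 / y" by linarith
    then show ?thesis using cf_expansion_pos(1)[OF c] by simp
  qed
  show "y \<in> {0<..<1}" using y lt1[OF assms] by simp
  have eq: "y = 1 / (real (a 0) + z)" using y by (simp add: z_def)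
  have "0 \<le> z" "z < 1" using cf_expansion_pos(1)[OF z] lt1[OF z] by auto
  from gauss_step[OF eq this] z eq
  show "gauss_digit y = a 0" "cf_expansion (gauss_map y) (\<lambda>i. a (Suc i))"
    "y = 1 / (real (a 0) + gauss_map y)" by auto
qed

lemma cf_expansion_digits:
  "cf_expansion y a \<Longrightarrow> a i = gauss_digit ((gauss_map ^^ i) y)"
proof (induction i arbitrary: y a)
  case 0
  then show ?case using cf_expansion_step(2) by simp
next
  case (Suc i)
  show ?case using Suc.IH[OF cf_expansion_step(3)[OF Suc.prems]]
    by (simp del: funpow.simps add: funpow_Suc_right)
qed

lemma irrational_in_cylinder_iff:
  assumes "y \<in> {0<..<1} - \<rat>"
  shows "y \<in> cylinder w \<longleftrightarrow> (\<forall>i<length w. gauss_digit ((gauss_map ^^ i) y) = w ! i)"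
proof
  assume "y \<in> cylinder w"
  then show "\<forall>i<length w. gauss_digit ((gauss_map ^^ i) y) = w ! i"
    by (auto simp: cylinder_def cf_expansion_digits)
next
  assume "\<forall>i<length w. gauss_digit ((gauss_map ^^ i) y) = w ! i"
  then show "y \<in> cylinder w" using irrational_cf_expansion[OF assms] assms
    by (auto simp: cylinder_def)
qed

section \<open>Cylinders as intervals and their Gauss measure\<close>

text \<open>Which endpoint is the smaller one depends on the parity of the length;
  \<open>min\<close> and \<open>max\<close> spare the case distinction.\<close>

definition cf_interval :: "nat list \<Rightarrow> real set" where
  "cf_interval w = {min (cf_branch w 0) (cf_branch w 1)<..<max (cf_branch w 0) (cf_branch w 1)}"

lemma cf_interval_unit:
  assumes "\<forall>d\<in>set w. d > 0"
  shows "cf_interval w \<subseteq> {0<..<1}"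
  using cf_branch_unit[OF assms, of 0] cf_branch_unit[OF assms, of 1]
  by (auto simp: cf_interval_def)

lemma cf_interval_Cons:
  assumes "\<forall>d\<in>set (a # w). d > 0" "z \<ge> 0"
  shows "1 / (real a + z) \<in> cf_interval (a # w) \<longleftrightarrow> z \<in> cf_interval w"
proof -
  have nn: "cf_branch w 0 \<ge> 0" "cf_branch w 1 \<ge> 0" and "real a > 0"
    using cf_branch_unit[of w 0] cf_branch_unit[of w 1] assms by auto
  then have less: "1 / (real a + u) < 1 / (real a + v) \<longleftrightarrow> v < u" if "u \<ge> 0" "v \<ge> 0" for u v
    using that by (simp add: frac_less2 divide_less_cancel field_simps add_pos_nonneg)
  show ?thesis
    using nn assms(2) by (auto simp: cf_interval_def min_less_iff_disj less_max_iff_disj less)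
qed

lemma cylinder_subset_unit: "cylinder w \<subseteq> {0<..<1}"
  using cf_expansion_step(1) by (auto simp: cylinder_def)

lemma cylinder_subset_interval:
  assumes "\<forall>d\<in>set w. d > 0" "y \<in> cylinder w"
  shows "y \<in> cf_interval w"
  using assms
proof (induction w arbitrary: y)
  case Nil
  then show ?case using cylinder_subset_unit[of "[]"] by (auto simp: cf_interval_def)
next
  case (Cons b w)
  then obtain a where a: "cf_expansion y a" "\<And>i. i < Suc (length w) \<Longrightarrow> a i = (b # w) ! i"
    by (auto simp: cylinder_def)
  note st = cf_expansion_step[OF a(1)]
  have "gauss_map y \<in> {0..1}" using cf_expansion_step(1)[OF st(3)] by auto
  moreover have "\<forall>i<length w. a (Suc i) = w ! i" using a(2) by auto
  ultimately have "gauss_map y \<in> cylinder w" using st(3) by (auto simp: cylinder_def)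
  then have "gauss_map y \<in> cf_interval w" using Cons by simp
  moreover have "y = 1 / (real b + gauss_map y)" using st(4) a(2)[of 0] by simp
  ultimately show ?case
    using cf_interval_Cons[OF Cons.prems(1), of "gauss_map y"] \<open>gauss_map y \<in> {0..1}\<close> by simp
qed

lemma cf_interval_digits:
  assumes "\<forall>d\<in>set w. d > 0" "y \<in> cf_interval w"
  shows "\<forall>i<length w. gauss_digit ((gauss_map ^^ i) y) = w ! i"
  using assms
proof (induction w arbitrary: y)
  case (Cons a w)
  have "y > 0" "y < 1" using cf_interval_unit[OF Cons.prems(1)] Cons.prems(2) by auto
  define z where "z = 1 / y - real a"
  have y: "y = 1 / (real a + z)" using \<open>y > 0\<close> by (simp add: z_def)
  \<comment> \<open>Both endpoints are at most 1 / a, so the remainder \<open>z\<close> is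
    nonnegative, as \<open>cf_interval_Cons\<close> and \<open>gauss_step\<close> require.\<close>
  have "cf_branch (a # w) u \<le> 1 / real a" if "u \<in> {0..1}" for u
    using cf_branch_unit[of w u] that Cons.prems(1) by (auto intro!: divide_left_mono)
  from this[of 0] this[of 1] have "y \<le> 1 / real a"
    using Cons.prems(2) by (auto simp: cf_interval_def)
  then have z0: "z \<ge> 0" using \<open>y > 0\<close> Cons.prems(1) by (simp add: z_def field_simps)
  then have zi: "z \<in> cf_interval w" using Cons.prems cf_interval_Cons y by metis
  then have "z < 1" using cf_interval_unit[of w] Cons.prems(1) by auto
  note st = gauss_step[OF y z0 this]
  show ?case
  proof (intro allI impI)
    fix i assume "i < length (a # w)"
    then show "gauss_digit ((gauss_map ^^ i) y) = (a # w) ! i"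
      using Cons.IH[OF _ zi] Cons.prems(1) st
      by (cases i) (auto simp del: funpow.simps simp add: funpow_Suc_right)
  qed
qed simp

text \<open>The normalized increment of ln (1 + x), an antiderivative of 1 / (1 + x), over the
  interval of \<open>w\<close>.\<close>

definition gauss_length :: "nat list \<Rightarrow> real" where
  "gauss_length w = \<bar>ln (1 + cf_branch w 1) - ln (1 + cf_branch w 0)\<bar> / ln 2"

text \<open>The cylinder differs from the closed interval between its endpoints by rationals and
  those endpoints only, hence by a null set; the integral over the interval is elementary.\<close>

lemma measure_cylinder:
  assumes pos: "\<forall>d\<in>set w. d > 0"
  shows "measure gauss_measure (cylinder w) = gauss_length w"
proof -
  define lo hi where "lo = min (cf_branch w 0) (cf_branch w 1)" and "hi = max (cf_branch w 0) (cf_branch w 1)"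
  have bd: "0 \<le> lo" "lo \<le> hi" "hi \<le> 1"
    using cf_branch_unit[OF pos, of 0] cf_branch_unit[OF pos, of 1] by (auto simp: lo_def hi_def)
  have sub: "cylinder w \<subseteq> {lo<..<hi}"
    using cylinder_subset_interval[OF pos] by (auto simp: cf_interval_def lo_def hi_def)
  have sup: "{lo<..<hi} - \<rat> \<subseteq> cylinder w"
    using irrational_in_cylinder_iff cf_interval_digits[OF pos] cf_interval_unit[OF pos]
    unfolding cf_interval_def lo_def hi_def by blast
  \<comment> \<open>Measurability: the irrational part of the cylinder is the open interval without
    the rationals, and what remains is countable.\<close>
  have eq: "cylinder w = ({lo<..<hi} - \<rat>) \<union> (cylinder w \<inter> \<rat>)" using sub sup by blast
  have c: "countable (cylinder w \<inter> \<rat>)" by (rule countable_subset[OF _ countable_rat]) auto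
  have meas: "cylinder w \<in> sets borel"
    by (subst eq) (intro sets.Un sets.Diff; simp add: c countable_rat sets.countable)
  have diff: "sym_diff (cylinder w) {lo..hi} \<subseteq> \<rat> \<union> {lo, hi}"
  proof
    fix y assume "y \<in> sym_diff (cylinder w) {lo..hi}"
    then consider "y \<in> cylinder w" "y \<notin> {lo..hi}" | "y \<notin> cylinder w" "y \<in> {lo..hi}" by blast
    then show "y \<in> \<rat> \<union> {lo, hi}"
    proof cases
      case 1
      then show ?thesis using subsetD[OF sub 1(1)] by simp
    next
      case 2
      then have "y \<in> \<rat> \<or> y \<notin> {lo<..<hi}" using sup by blast
      with 2(2) show ?thesis by (auto simp: less_le)
    qed
  qed
  have null: "AE y in lborel. y \<in> cylinder w \<longleftrightarrow> y \<in> {lo..hi}"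
  proof (rule AE_I')
    show "\<rat> \<union> {lo, hi} \<in> null_sets lborel"
      by (rule countable_imp_null_set_lborel) (simp add: countable_rat)
    show "{y \<in> space lborel. \<not> (y \<in> cylinder w \<longleftrightarrow> y \<in> {lo..hi})} \<subseteq> \<rat> \<union> {lo, hi}"
      using diff by blast
  qed
  have "(LINT y:cylinder w|lborel. 1 / (1 + y)) = (LINT y:{lo..hi}|lborel. 1 / (1 + y))"
    unfolding set_lebesgue_integral_def
  proof (rule integral_cong_AE)
    show "(\<lambda>y. indicator (cylinder w) y *\<^sub>R (1 / (1 + y))) \<in> borel_measurable lborel"
      using meas by measurable
    show "AE y in lborel. indicator (cylinder w) y *\<^sub>R (1 / (1 + y)) = indicator {lo..hi} y *\<^sub>R (1 / (1 + y))"
      using null by eventually_elim (auto simp: indicator_def)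
  qed simp
  also have "\<dots> = ln (1 + hi) - ln (1 + lo)"
    unfolding set_lebesgue_integral_def
    by (rule integral_FTC_atLeastAtMost)
       (use bd in \<open>auto intro!: derivative_eq_intros continuous_intros
          simp: has_real_derivative_iff_has_vector_derivative[symmetric]\<close>)
  also have "\<dots> = \<bar>ln (1 + cf_branch w 1) - ln (1 + cf_branch w 0)\<bar>"
    using bd by (auto simp: lo_def hi_def min_def max_def abs_if)
  finally show ?thesis
    using measure_gauss_measure[OF meas cylinder_subset_unit] by (simp add: gauss_length_def)
qed

section \<open>Mixing of the Gauss map\<close>

lemma density_cdf_1: "s \<ge> 0 \<Longrightarrow> density_cdf s 1 = 1"
  by (simp add: density_cdf_def)

text \<open>\<open>word_prob w s\<close> is, up to sign, the increment of
  \<open>density_cdf s\<close> between the endpoints. Dividing by 1 + s leaves terms h / (1 + s h),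
  whose integral over \<open>s\<close> is ln (1 + h).\<close>

lemma gauss_length_integral:
  assumes pos: "\<forall>d\<in>set w. d > 0"
  shows "((\<lambda>s. word_prob w s / (1 + s)) has_integral ln 2 * gauss_length w) {0..1}"
proof -
  define h0 h1 where "h0 = cf_branch w 0" and "h1 = cf_branch w 1"
  define D where "D = (ln (1 + h1) - ln (1 + h0))"
  have h: "h0 \<ge> 0" "h1 \<ge> 0"
    using cf_branch_unit[OF pos, of 0] cf_branch_unit[OF pos, of 1] by (auto simp: h0_def h1_def)
  have I: "((\<lambda>s. h1 / (1 + s * h1) - h0 / (1 + s * h0)) has_integral D) {0..1}"
  proof -
    have "((\<lambda>s. h / (1 + s * h)) has_integral ln (1 + h)) {0..1}" if "h \<ge> 0" for h :: real
    proof -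
      have "((\<lambda>s. h / (1 + s * h)) has_integral ln (1 + 1 * h) - ln (1 + 0 * h)) {0..1}"
        using that
        by (intro fundamental_theorem_of_calculus)
           (auto intro!: derivative_eq_intros add_pos_nonneg
             simp: has_real_derivative_iff_has_vector_derivative[symmetric])
      then show ?thesis by simp
    qed
    from has_integral_diff[OF this[OF h(2)] this[OF h(1)]] show ?thesis by (simp add: D_def)
  qed
  have eq: "word_prob w s / (1 + s) = (-1) ^ length w * (h1 / (1 + s * h1) - h0 / (1 + s * h0))"
    if s: "s \<in> {0..1}" for s
  proof -
    have st: "word_state w s \<ge> 0" using word_state_unit[OF pos s] by simp
    have "density_cdf s h1 - density_cdf s h0 = (-1) ^ length w * word_prob w s"
      using density_cdf_branch[OF pos s, of 1] density_cdf_1[OF st] by (simp add: h0_def h1_def)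
    then have "word_prob w s = (-1) ^ length w * (density_cdf s h1 - density_cdf s h0)"
      by (simp add: power_add[symmetric] flip: mult.assoc)
    also have "\<dots> / (1 + s) = (-1) ^ length w * (density_cdf s h1 / (1 + s) - density_cdf s h0 / (1 + s))"
      by (metis diff_divide_distrib times_divide_eq_right)
    also have "density_cdf s h1 / (1 + s) = h1 / (1 + s * h1)"
      using s by (simp add: density_cdf_def)
    also have "density_cdf s h0 / (1 + s) = h0 / (1 + s * h0)"
      using s by (simp add: density_cdf_def)
    finally show ?thesis .
  qed
  have J: "((\<lambda>s. word_prob w s / (1 + s)) has_integral (-1) ^ length w * D) {0..1}"
    using has_integral_mult_right[OF I] eq by (subst has_integral_cong) auto
  \<comment> \<open>The sign is settled without parity: the integrand is nonnegative, so the signed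
    value equals its absolute value.\<close>
  have "0 \<le> (-1) ^ length w * D"
    by (rule has_integral_nonneg[OF J]) (use word_prob_bounds[OF pos] in auto)
  then have "(-1) ^ length w * D = \<bar>(-1) ^ length w * D\<bar>" by simp
  also have "\<dots> = \<bar>D\<bar>" by (simp add: abs_mult power_abs)
  also have "\<dots> = ln 2 * gauss_length w" by (simp add: gauss_length_def D_def h0_def h1_def)
  finally show ?thesis using J by simp
qed

lemma gauss_length_nonneg: "gauss_length w \<ge> 0"
  by (simp add: gauss_length_def)

lemma gauss_length_Nil: "gauss_length [] = 1"
  by (simp add: gauss_length_def)

section \<open>Invariance of the Gauss measure with digits cut off at \<open>K\<close>\<close>

text \<open>Since 1 + 1 / (a + v) = (a + 1 + v) / (a + v), the sum over the digits
  telescopes.\<close>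

lemma sum_ln_digit:
  fixes x y :: real
  assumes "0 \<le> x" "x \<le> y"
  shows "(\<Sum>a=1..K. \<bar>ln (1 + 1 / (real a + y)) - ln (1 + 1 / (real a + x))\<bar>)
    = ln (1 + y) - ln (1 + x) - (ln (real K + 1 + y) - ln (real K + 1 + x))"
proof (induction K)
  case (Suc K)
  let ?a = "real (Suc K)"
  have split: "ln (1 + 1 / (?a + v)) = ln (?a + 1 + v) - ln (?a + v)" if "v \<ge> 0" for v
  proof -
    have "1 + 1 / (?a + v) = (?a + 1 + v) / (?a + v)" using that by (simp add: field_simps)
    then show ?thesis using that by (simp only:) (subst ln_div; simp)
  qed
  have "ln (1 + 1 / (?a + y)) \<le> ln (1 + 1 / (?a + x))"
    using assms by (subst ln_le_cancel_iff) (auto intro!: add_pos_nonneg divide_left_mono)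
  then have "\<bar>ln (1 + 1 / (?a + y)) - ln (1 + 1 / (?a + x))\<bar>
    = (ln (?a + 1 + x) - ln (?a + x)) - (ln (?a + 1 + y) - ln (?a + y))"
    using split[of x] split[of y] assms by simp
  moreover have "?a = real K + 1" by simp
  ultimately show ?case using Suc by (simp only: sum.cl_ivl_Suc) (simp add: add_ac)
qed (simp add: add_ac)

text \<open>Prepending all digits forms the preimage under the Gauss map, which has the same Gauss
  measure. The subtracted term is the part of the preimage with first digit above
  \<open>K\<close>.\<close>

lemma sum_gauss_length_Cons:
  "(\<Sum>a=1..K. gauss_length (a # w)) =
    gauss_length w - \<bar>ln (real K + 1 + cf_branch w 1) - ln (real K + 1 + cf_branch w 0)\<bar> / ln 2"
  if pos: "\<forall>d\<in>set w. d > 0"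
proof -
  define x y where "x = cf_branch w 0" and "y = cf_branch w 1"
  have nn: "x \<ge> 0" "y \<ge> 0"
    using cf_branch_unit[OF pos, of 0] cf_branch_unit[OF pos, of 1] by (auto simp: x_def y_def)
  have *: "(\<Sum>a=1..K. \<bar>ln (1 + 1 / (real a + y)) - ln (1 + 1 / (real a + x))\<bar>)
    = \<bar>ln (1 + y) - ln (1 + x)\<bar> - \<bar>ln (real K + 1 + y) - ln (real K + 1 + x)\<bar>"
  proof (cases "x \<le> y")
    case True
    then show ?thesis using nn sum_ln_digit[OF nn(1) True, of K] by simp
  next
    case False
    then have le: "y \<le> x" by simp
    then show ?thesis using nn sum_ln_digit[OF nn(2) le, of K] by (simp add: abs_minus_commute)
  qed
  have "(\<Sum>a=1..K. gauss_length (a # w))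
    = (\<Sum>a=1..K. \<bar>ln (1 + 1 / (real a + y)) - ln (1 + 1 / (real a + x))\<bar>) / ln 2"
    by (simp add: gauss_length_def x_def y_def sum_divide_distrib)
  then show ?thesis unfolding * by (simp add: gauss_length_def x_def y_def diff_divide_distrib)
qed

lemma sum_gauss_length_Cons_le:
  assumes "\<forall>d\<in>set w. d > 0"
  shows "(\<Sum>a=1..K. gauss_length (a # w)) \<le> gauss_length w"
  unfolding sum_gauss_length_Cons[OF assms] by simp

text \<open>The missing mass is ln (1 + 1 / (K + 1)) / ln 2; the 2 comes from ln 2 \<ge>
  1/2.\<close>

lemma sum_gauss_length_digit:
  assumes "K > 0"
  shows "1 - 2 / real K \<le> (\<Sum>a=1..K. gauss_length [a])"
proof -
  have "1 + 1 / (real K + 1) = (real K + 2) / (real K + 1)" by (simp add: field_simps)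
  then have "ln (real K + 2) - ln (real K + 1) = ln (1 + 1 / (real K + 1))"
    by (simp only:) (subst ln_div; simp)
  also have "\<dots> \<le> 1 / (real K + 1)" by (rule ln_add_one_self_le_self) simp
  also have "\<dots> \<le> 1 / real K" using assms by (intro divide_left_mono) auto
  finally have "ln (real K + 2) - ln (real K + 1) \<le> 1 / real K" .
  moreover have "ln (2::real) \<ge> 1 / 2" using ln2_ge_two_thirds by simp
  ultimately have "(ln (real K + 2) - ln (real K + 1)) / ln 2 \<le> (1 / real K) / (1 / 2)"
    by (intro frac_le) auto
  moreover have "\<bar>ln (real K + 1 + cf_branch [] 1) - ln (real K + 1 + cf_branch [] 0)\<bar>
      = ln (real K + 2) - ln (real K + 1)"
    by (simp add: add_ac)
  ultimately show ?thesis
    using sum_gauss_length_Cons[of "[]" K] by (simp only: gauss_length_Nil) simp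
qed

section \<open>Averages over words with digits at most \<open>K\<close>\<close>

text \<open>The cutoff \<open>K\<close> keeps all sums over words finite; the mass it loses is
  estimated separately.\<close>

definition words :: "nat \<Rightarrow> nat \<Rightarrow> nat list set" where
  "words K k = {u. set u \<subseteq> {1..K} \<and> length u = k}"

lemma finite_words: "finite (words K k)"
  by (simp add: words_def finite_lists_length_eq)

lemma words_pos: "u \<in> words K k \<Longrightarrow> \<forall>d\<in>set u. d > 0"
  by (auto simp: words_def)

lemma words_0: "words K 0 = {[]}"
  by (auto simp: words_def)

lemma sum_words_Suc: "(\<Sum>u\<in>words K (Suc k). f u) = (\<Sum>a=1..K. \<Sum>u\<in>words K k. f (a # u))"
proof -
  have "words K (Suc k) = (\<lambda>(a, u). a # u) ` ({1..K} \<times> words K k)"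
    by (auto simp: words_def length_Suc_conv image_iff)
  moreover have "inj_on (\<lambda>(a, u). a # u) ({1..K} \<times> words K k)" by (auto simp: inj_on_def)
  ultimately show ?thesis by (simp add: sum.reindex sum.cartesian_product case_prod_unfold)
qed

lemma sum_gauss_length_prefix_le:
  assumes "\<forall>d\<in>set w. d > 0"
  shows "(\<Sum>u\<in>words K k. gauss_length (u @ w)) \<le> gauss_length w"
proof (induction k)
  case (Suc k)
  have "(\<Sum>u\<in>words K (Suc k). gauss_length (u @ w))
    = (\<Sum>u\<in>words K k. \<Sum>a=1..K. gauss_length (a # (u @ w)))"
    by (simp add: sum_words_Suc) (rule sum.swap)
  also have "\<dots> \<le> (\<Sum>u\<in>words K k. gauss_length (u @ w))"
    by (intro sum_mono sum_gauss_length_Cons_le) (use assms words_pos in force)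
  finally show ?case using Suc by linarith
qed (simp add: words_0)

text \<open>The k-th power of the transition operator of the Markov chain of parameters, with digits
  above \<open>K\<close> discarded.\<close>

definition word_avg :: "nat \<Rightarrow> nat \<Rightarrow> (real \<Rightarrow> real) \<Rightarrow> real \<Rightarrow> real" where
  "word_avg K k f s = (\<Sum>u\<in>words K k. word_prob u s * f (word_state u s))"

lemma word_avg_0: "word_avg K 0 f s = f s"
  by (simp add: word_avg_def words_0)

lemma word_avg_Suc:
  "word_avg K (Suc k) f s = (\<Sum>a=1..K. digit_prob a s * word_avg K k f (1 / (real a + s)))"
  by (simp add: word_avg_def sum_words_Suc sum_distrib_left mult.assoc)

text \<open>(1 + s) / (n + s) is the probability that the first digit is at least n.\<close>

lemma digit_prob_eq_diff:
  assumes "a > 0" "s \<ge> 0"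
  shows "digit_prob a s = (1 + s) / (real a + s) - (1 + s) / (real (Suc a) + s)"
proof -
  have "real a + s > 0" using assms by simp
  then show ?thesis by (simp add: digit_prob_def divide_simps) (simp add: algebra_simps)
qed

lemma sum_digit_prob:
  assumes "s \<ge> 0"
  shows "(\<Sum>a=1..K. digit_prob a s) = 1 - (1 + s) / (real (Suc K) + s)"
  using assms by (induction K) (simp_all add: digit_prob_eq_diff)

lemma sum_digit_prob_le_1:
  assumes "s \<ge> 0"
  shows "(\<Sum>a=1..K. digit_prob a s) \<le> 1"
  unfolding sum_digit_prob[OF assms] using assms by simp

lemma word_avg_bounds:
  assumes "\<And>s. s \<in> {0..1} \<Longrightarrow> f s \<in> {0..1}" "s \<in> {0..1}"
  shows "word_avg K k f s \<in> {0..1}"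
  using assms(2)
proof (induction k arbitrary: s)
  case (Suc k)
  have a: "0 \<le> digit_prob a s" "word_avg K k f (1 / (real a + s)) \<in> {0..1}" if "a \<in> {1..K}" for a
    using that Suc digit_prob_bounds[of a s] state_step[of a s] by auto
  have "(\<Sum>a=1..K. digit_prob a s * word_avg K k f (1 / (real a + s))) \<le> (\<Sum>a=1..K. digit_prob a s)"
    by (intro sum_mono mult_left_le) (use a in auto)
  moreover have "0 \<le> (\<Sum>a=1..K. digit_prob a s * word_avg K k f (1 / (real a + s)))"
    by (intro sum_nonneg mult_nonneg_nonneg) (use a in auto)
  ultimately show ?case using sum_digit_prob_le_1[of s K] Suc.prems by (simp add: word_avg_Suc)
qed (use assms(1) in \<open>simp add: word_avg_0\<close>)

section \<open>Contraction of Lipschitz constants\<close>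

lemma state_step_lipschitz:
  assumes "a > 0" "s \<ge> 0" "s' \<ge> 0"
  shows "\<bar>1 / (real a + s) - 1 / (real a + s')\<bar> \<le> \<bar>s - s'\<bar> / real a ^ 2"
proof -
  have p: "real a > 0" "real a + s > 0" "real a + s' > 0" using assms by auto
  have "1 / (real a + s) - 1 / (real a + s') = (s' - s) / ((real a + s) * (real a + s'))"
    using p by (simp add: divide_simps)
  then have "\<bar>1 / (real a + s) - 1 / (real a + s')\<bar> = \<bar>s - s'\<bar> / ((real a + s) * (real a + s'))"
    using p by (simp add: abs_mult abs_minus_commute)
  also have "\<dots> \<le> \<bar>s - s'\<bar> / real a ^ 2"
    unfolding power2_eq_square using p assms by (intro divide_left_mono mult_mono mult_pos_pos) auto
  finally show ?thesis .
qed

text \<open>The factor n - 1 reflects that at n = 1 the tail probability is 1 for every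
  parameter.\<close>

lemma digit_tail_diff:
  assumes "n \<ge> 1" "s \<ge> 0" "s' \<ge> 0"
  shows "\<bar>(1 + s) / (real n + s) - (1 + s') / (real n + s')\<bar> \<le> \<bar>s - s'\<bar> * (real n - 1) / real n ^ 2"
proof -
  have p: "real n \<ge> 1" "real n + s > 0" "real n + s' > 0" using assms by auto
  have "(1 + s) / (real n + s) - (1 + s') / (real n + s')
      = ((s - s') * (real n - 1)) / ((real n + s) * (real n + s'))"
    using p by (simp add: divide_simps) (simp add: algebra_simps)
  then have "\<bar>(1 + s) / (real n + s) - (1 + s') / (real n + s')\<bar>
      = (\<bar>s - s'\<bar> * (real n - 1)) / ((real n + s) * (real n + s'))"
    using p by (simp add: abs_mult)
  also have "\<dots> \<le> \<bar>s - s'\<bar> * (real n - 1) / real n ^ 2"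
    unfolding power2_eq_square using p assms by (intro divide_left_mono mult_mono mult_pos_pos) auto
  finally show ?thesis .
qed

text \<open>Summation by parts, with \<open>\<Delta>\<close> a difference of tail probabilities of the first digit; the bound
  comes from \<open>(\<Sum>n=2..K. 1 / ((n - 1) * n * (n + 1))) = 1 / 4 - 1 / (2 * K * (K + 1))\<close>.\<close>

lemma digit_tail_summation:
  fixes \<Delta> \<phi> :: "nat \<Rightarrow> real"
  assumes "K \<ge> 1" "\<Delta> 1 = 0" "C \<ge> 0"
    and \<Delta>: "\<And>n. n \<ge> 1 \<Longrightarrow> \<bar>\<Delta> n\<bar> \<le> C * (real n - 1) / real n ^ 2"
    and \<phi>: "\<And>n. n \<ge> 1 \<Longrightarrow> \<bar>\<phi> (Suc n) - \<phi> n\<bar> \<le> M / (real n * real (Suc n))"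
  shows "\<bar>(\<Sum>a=1..K. (\<Delta> a - \<Delta> (Suc a)) * \<phi> a) + \<Delta> (Suc K) * \<phi> K\<bar>
    \<le> C * M * (1 / 4 - 1 / (2 * real K * (real K + 1)))"
  using assms(1)
proof (induction K rule: dec_induct)
  case base
  then show ?case using assms(2) by simp
next
  case (step K)
  let ?E = "\<lambda>K. (\<Sum>a=1..K. (\<Delta> a - \<Delta> (Suc a)) * \<phi> a) + \<Delta> (Suc K) * \<phi> K"
  have K: "real K \<ge> 1" using step.hyps by simp
  have M: "M \<ge> 0" using order.trans[OF abs_ge_zero \<phi>[of 1]] by simp
  have "?E (Suc K) = ?E K + \<Delta> (Suc K) * (\<phi> (Suc K) - \<phi> K)"
    by (simp add: algebra_simps)
  then have "\<bar>?E (Suc K)\<bar> \<le> \<bar>?E K\<bar> + \<bar>\<Delta> (Suc K)\<bar> * \<bar>\<phi> (Suc K) - \<phi> K\<bar>"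
    by (simp only: abs_mult[symmetric] abs_triangle_ineq)
  also have "\<bar>\<Delta> (Suc K)\<bar> * \<bar>\<phi> (Suc K) - \<phi> K\<bar>
      \<le> (C * (real (Suc K) - 1) / real (Suc K) ^ 2) * (M / (real K * real (Suc K)))"
    using \<Delta>[of "Suc K"] \<phi>[of K] step.hyps assms(3) by (intro mult_mono) auto
  also have "\<dots> = C * M * (1 / (real K + 1) ^ 3)"
  proof -
    have "(C * k / n ^ 2) * (M / (k * n)) = C * M * (1 / n ^ 3)" if "k > 0" "n > 0" for k n :: real
      using that by (simp add: power2_eq_square power3_eq_cube)
    from this[of "real K" "real K + 1"] show ?thesis using K by (simp add: add_ac)
  qed
  \<comment> \<open>Replacing the cube by the smaller product K (K + 1) (K + 2) turns the increment
    into one that telescopes.\<close>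
  also have "\<dots> \<le> C * M * (1 / (real K * (real K + 1) * (real K + 2)))"
  proof (intro mult_left_mono divide_left_mono)
    show "real K * (real K + 1) * (real K + 2) \<le> (real K + 1) ^ 3"
      using K by (simp add: power3_eq_cube algebra_simps)
  qed (use K M assms(3) in \<open>auto intro!: mult_pos_pos\<close>)
  also have "1 / (real K * (real K + 1) * (real K + 2))
      = 1 / (2 * real K * (real K + 1)) - 1 / (2 * real (Suc K) * (real (Suc K) + 1))"
    using K by (simp add: divide_simps) (simp add: algebra_simps)
  finally have "\<bar>?E (Suc K)\<bar> \<le> \<bar>?E K\<bar> + C * M * (1 / (2 * real K * (real K + 1))
      - 1 / (2 * real (Suc K) * (real (Suc K) + 1)))" by simp
  also note add_right_mono[OF step.IH]
  finally show ?case by (simp only: distrib_left[symmetric]) simp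
qed

text \<open>Moving the new parameters 1 / (a + s) costs 5/8 \<open>M\<close>, because only digit 1
  fails to contract by 1/4. Changing the digit probabilities costs 1/4 \<open>M\<close> by
  \<open>digit_tail_summation\<close>. Together this is 7/8 \<open>M\<close>; the cutoff at
  \<open>K\<close> leaves a boundary term of size 1 / K.\<close>

lemma digit_average_lipschitz:
  assumes K: "K \<ge> 1" and f: "\<And>s. s \<in> {0..1} \<Longrightarrow> f s \<in> {0..1}"
    and lip: "\<And>s s'. s \<in> {0..1} \<Longrightarrow> s' \<in> {0..1} \<Longrightarrow> \<bar>f s - f s'\<bar> \<le> M * \<bar>s - s'\<bar>"
    and s: "s \<in> {0..1}" "s' \<in> {0..1}"
  shows "\<bar>(\<Sum>a=1..K. digit_prob a s * f (1 / (real a + s)))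
      - (\<Sum>a=1..K. digit_prob a s' * f (1 / (real a + s')))\<bar> \<le> (7 / 8 * M + 1 / real K) * \<bar>s - s'\<bar>"
proof -
  define \<phi> where "\<phi> a = f (1 / (real a + s))" for a
  define \<Delta> where "\<Delta> n = (1 + s) / (real n + s) - (1 + s') / (real n + s')" for n
  have M: "M \<ge> 0" using lip[of 0 1] by simp
  have ss: "s \<ge> 0" "s' \<ge> 0" using s by auto
  have "\<bar>\<Sum>a=1..K. digit_prob a s' * (\<phi> a - f (1 / (real a + s')))\<bar>
      \<le> (\<Sum>a=1..K. digit_prob a s' * (M * \<bar>s - s'\<bar> * (1 / 4 + (if a = 1 then 3 / 4 else 0))))"
  proof (rule order.trans[OF sum_abs sum_mono])
    fix a assume a: "a \<in> {1..K}"
    have sq: "1 / real a ^ 2 \<le> 1 / 4 + (if a = 1 then 3 / 4 else 0)"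
    proof (cases "a = 1")
      case False
      then have "real a \<ge> 2" using a by auto
      then have "2 * 2 \<le> real a * real a" by (intro mult_mono) auto
      then show ?thesis using False by (simp add: power2_eq_square divide_simps)
    qed simp
    have "\<bar>\<phi> a - f (1 / (real a + s'))\<bar> \<le> M * \<bar>1 / (real a + s) - 1 / (real a + s')\<bar>"
      unfolding \<phi>_def using a s state_step by (intro lip) auto
    also have "\<dots> \<le> M * (\<bar>s - s'\<bar> / real a ^ 2)"
      using M state_step_lipschitz[of a s s'] a ss by (intro mult_left_mono) auto
    also have "\<dots> = M * \<bar>s - s'\<bar> * (1 / real a ^ 2)" by simp
    also have "\<dots> \<le> M * \<bar>s - s'\<bar> * (1 / 4 + (if a = 1 then 3 / 4 else 0))"
      using sq M by (intro mult_left_mono) auto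
    finally show "\<bar>digit_prob a s' * (\<phi> a - f (1 / (real a + s')))\<bar>
        \<le> digit_prob a s' * (M * \<bar>s - s'\<bar> * (1 / 4 + (if a = 1 then 3 / 4 else 0)))"
      using digit_prob_bounds[of a s'] a s by (simp add: abs_mult mult_left_mono)
  qed
  also have "\<dots> = M * \<bar>s - s'\<bar> * (1 / 4 * (\<Sum>a=1..K. digit_prob a s') + 3 / 4 * digit_prob 1 s')"
  proof -
    have "(\<Sum>a=1..K. digit_prob a s' * (M * \<bar>s - s'\<bar> * (1 / 4 + (if a = 1 then 3 / 4 else 0))))
      = (\<Sum>a=1..K. M * \<bar>s - s'\<bar> * (1 / 4 * digit_prob a s') +
          (if a = 1 then M * \<bar>s - s'\<bar> * (3 / 4 * digit_prob a s') else 0))"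
      by (intro sum.cong) (auto simp: algebra_simps)
    also have "\<dots> = M * \<bar>s - s'\<bar> * (1 / 4 * (\<Sum>a=1..K. digit_prob a s')) + M * \<bar>s - s'\<bar> * (3 / 4 * digit_prob 1 s')"
      using K by (simp add: sum.distrib sum.delta sum_distrib_left)
    finally show ?thesis by (simp add: distrib_left)
  qed
  \<comment> \<open>5/8 = 1/4 + 3/4 * 1/2: the digits have total probability at most 1, and digit 1
    has at most 1/2.\<close>
  also have "\<dots> \<le> M * \<bar>s - s'\<bar> * (5 / 8)"
    using sum_digit_prob_le_1[of s' K] digit_prob_bounds[of 1 s'] s M by (intro mult_left_mono) auto
  finally have E1: "\<bar>\<Sum>a=1..K. digit_prob a s' * (\<phi> a - f (1 / (real a + s')))\<bar> \<le> M * \<bar>s - s'\<bar> * (5 / 8)" .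
  have "\<bar>(\<Sum>a=1..K. (\<Delta> a - \<Delta> (Suc a)) * \<phi> a) + \<Delta> (Suc K) * \<phi> K\<bar>
    \<le> \<bar>s - s'\<bar> * M * (1 / 4 - 1 / (2 * real K * (real K + 1)))"
  proof (rule digit_tail_summation[OF K])
    show "\<bar>\<Delta> n\<bar> \<le> \<bar>s - s'\<bar> * (real n - 1) / real n ^ 2" if "n \<ge> 1" for n
      unfolding \<Delta>_def by (rule digit_tail_diff[OF that ss])
    show "\<bar>\<phi> (Suc n) - \<phi> n\<bar> \<le> M / (real n * real (Suc n))" if "n \<ge> 1" for n
    proof -
      have p: "real n > 0" using that by simp
      have "\<bar>\<phi> (Suc n) - \<phi> n\<bar> \<le> M * \<bar>1 / (real (Suc n) + s) - 1 / (real n + s)\<bar>"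
        unfolding \<phi>_def using that s state_step[of n s] state_step[of "Suc n" s] by (intro lip) auto
      also have "1 / (real (Suc n) + s) - 1 / (real n + s) = - (1 / ((real n + s) * (real (Suc n) + s)))"
        using p ss by (simp add: divide_simps)
      also have "\<bar>\<dots>\<bar> = 1 / ((real n + s) * (real (Suc n) + s))"
        using p ss by simp
      also have "M * \<dots> \<le> M * (1 / (real n * real (Suc n)))"
        using p ss M by (intro mult_left_mono divide_left_mono mult_mono mult_pos_pos) auto
      finally show ?thesis by simp
    qed
  qed (use ss in \<open>auto simp: \<Delta>_def\<close>)
  also have "\<dots> \<le> \<bar>s - s'\<bar> * M * (1 / 4)"
    using M by (intro mult_left_mono) auto
  finally have E2: "\<bar>(\<Sum>a=1..K. (\<Delta> a - \<Delta> (Suc a)) * \<phi> a) + \<Delta> (Suc K) * \<phi> K\<bar> \<le> \<bar>s - s'\<bar> * M * (1 / 4)" .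
  have "\<bar>\<Delta> (Suc K)\<bar> \<le> \<bar>s - s'\<bar> * (real (Suc K) - 1) / real (Suc K) ^ 2"
    unfolding \<Delta>_def by (rule digit_tail_diff) (use ss in auto)
  also have "\<dots> = \<bar>s - s'\<bar> * (real K / (real K + 1) ^ 2)" by (simp add: add_ac)
  also have "\<dots> \<le> \<bar>s - s'\<bar> * (1 / real K)"
  proof (intro mult_left_mono)
    have "real K * real K \<le> (real K + 1) ^ 2" by (simp add: power2_eq_square algebra_simps)
    moreover have "0 < (real K + 1) ^ 2" by simp
    ultimately show "real K / (real K + 1) ^ 2 \<le> 1 / real K" using K by (simp add: divide_simps)
  qed simp
  finally have "\<bar>\<Delta> (Suc K)\<bar> \<le> \<bar>s - s'\<bar> * (1 / real K)" .
  moreover have "\<bar>\<phi> K\<bar> \<le> 1" using f[OF state_step[of K s]] K s by (simp add: \<phi>_def)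
  ultimately have E3: "\<bar>\<Delta> (Suc K) * \<phi> K\<bar> \<le> \<bar>s - s'\<bar> * (1 / real K)"
    unfolding abs_mult using mult_mono[of "\<bar>\<Delta> (Suc K)\<bar>" "\<bar>s - s'\<bar> * (1 / real K)" "\<bar>\<phi> K\<bar>" 1] by simp
  define X Y Z where "X = (\<Sum>a=1..K. digit_prob a s' * (\<phi> a - f (1 / (real a + s'))))"
    and "Y = (\<Sum>a=1..K. (\<Delta> a - \<Delta> (Suc a)) * \<phi> a)" and "Z = \<Delta> (Suc K) * \<phi> K"
  have "(\<Sum>a=1..K. digit_prob a s * \<phi> a) - (\<Sum>a=1..K. digit_prob a s' * f (1 / (real a + s')))
    = X + (\<Sum>a=1..K. (digit_prob a s - digit_prob a s') * \<phi> a)"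
    by (simp add: X_def sum_subtractf[symmetric] sum.distrib[symmetric] algebra_simps)
  also have "(\<Sum>a=1..K. (digit_prob a s - digit_prob a s') * \<phi> a) = Y"
    unfolding Y_def using ss by (intro sum.cong) (auto simp: \<Delta>_def digit_prob_eq_diff)
  \<comment> \<open>The boundary term \<open>Z\<close> is inserted because summation by parts
    controls \<open>Y + Z\<close>, not \<open>Y\<close> alone.\<close>
  also have "\<bar>X + Y\<bar> \<le> \<bar>X\<bar> + \<bar>Y + Z\<bar> + \<bar>Z\<bar>" by linarith
  also have "\<dots> \<le> M * \<bar>s - s'\<bar> * (5 / 8) + \<bar>s - s'\<bar> * M * (1 / 4) + \<bar>s - s'\<bar> * (1 / real K)"
    using E1 E2 E3 by (intro add_mono) (simp_all add: X_def Y_def Z_def)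
  also have "\<dots> = (7 / 8 * M + 1 / real K) * \<bar>s - s'\<bar>" by (simp add: algebra_simps)
  finally show ?thesis unfolding \<phi>_def .
qed

text \<open>Iterates \<open>digit_average_lipschitz\<close>; 8 / K is the fixed point of c = 7/8 c +
  1 / K.\<close>

lemma word_avg_lipschitz:
  assumes K: "K \<ge> 1" and f: "\<And>s. s \<in> {0..1} \<Longrightarrow> f s \<in> {0..1}"
    and lip: "\<And>s s'. s \<in> {0..1} \<Longrightarrow> s' \<in> {0..1} \<Longrightarrow> \<bar>f s - f s'\<bar> \<le> M * \<bar>s - s'\<bar>"
    and s: "s \<in> {0..1}" "s' \<in> {0..1}"
  shows "\<bar>word_avg K k f s - word_avg K k f s'\<bar> \<le> ((7 / 8) ^ k * M + 8 / real K) * \<bar>s - s'\<bar>"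
  using s
proof (induction k arbitrary: s s')
  case 0
  have "\<bar>f s - f s'\<bar> \<le> M * \<bar>s - s'\<bar>" using lip 0 by simp
  also have "\<dots> \<le> (M + 8 / real K) * \<bar>s - s'\<bar>" by (intro mult_right_mono) auto
  finally show ?case by (simp add: word_avg_0)
next
  case (Suc k)
  have "\<bar>word_avg K (Suc k) f s - word_avg K (Suc k) f s'\<bar>
    \<le> (7 / 8 * ((7 / 8) ^ k * M + 8 / real K) + 1 / real K) * \<bar>s - s'\<bar>"
    unfolding word_avg_Suc
    by (rule digit_average_lipschitz[OF K]) (use word_avg_bounds f Suc in auto)
  then show ?case by (simp add: algebra_simps)
qed

lemma digit_prob_lipschitz:
  assumes "a > 0" "s \<in> {0..1}" "s' \<in> {0..1}"
  shows "\<bar>digit_prob a s - digit_prob a s'\<bar> \<le> \<bar>s - s'\<bar> / 2"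
proof -
  have le: "\<bar>s - s'\<bar> * (real n - 1) / real n ^ 2 \<le> \<bar>s - s'\<bar> * (1 / 4)" if "n \<ge> 1" for n
  proof -
    have "0 \<le> (real n - 2) ^ 2" by simp
    then have "4 * (real n - 1) \<le> real n ^ 2" by (simp add: power2_eq_square algebra_simps)
    then have "(real n - 1) / real n ^ 2 \<le> 1 / 4" using that by (simp add: divide_simps)
    then show ?thesis using mult_left_mono[of "(real n - 1) / real n ^ 2" "1 / 4" "\<bar>s - s'\<bar>"] by simp
  qed
  have ss: "s \<ge> 0" "s' \<ge> 0" using assms by auto
  have "\<bar>(1 + s) / (real a + s) - (1 + s') / (real a + s')\<bar> \<le> \<bar>s - s'\<bar> * (1 / 4)"
    by (rule order.trans[OF digit_tail_diff le]) (use assms in auto)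
  moreover have "\<bar>(1 + s) / (real (Suc a) + s) - (1 + s') / (real (Suc a) + s')\<bar> \<le> \<bar>s - s'\<bar> * (1 / 4)"
    by (rule order.trans[OF digit_tail_diff le]) (use assms in auto)
  ultimately show ?thesis
    unfolding digit_prob_eq_diff[OF assms(1) ss(1)] digit_prob_eq_diff[OF assms(1) ss(2)] by linarith
qed

text \<open>Each digit adds at most 1 to the constant, since the maps s -> 1 / (a + s) do not expand
  distances and all probabilities are at most 1. This is the constant that the averaging then
  contracts.\<close>

lemma word_prob_lipschitz:
  assumes "\<forall>d\<in>set w. d > 0" "s \<in> {0..1}" "s' \<in> {0..1}"
  shows "\<bar>word_prob w s - word_prob w s'\<bar> \<le> real (length w) * \<bar>s - s'\<bar>"
  using assms
proof (induction w arbitrary: s s')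
  case (Cons a w)
  define u u' where "u = 1 / (real a + s)" and "u' = 1 / (real a + s')"
  have a: "a > 0" "real a \<ge> 1" using Cons.prems by auto
  have w: "\<forall>d\<in>set w. d > 0" using Cons.prems by simp
  have u: "u \<in> {0..1}" "u' \<in> {0..1}" using state_step a Cons.prems by (auto simp: u_def u'_def)
  have "\<bar>s - s'\<bar> / real a ^ 2 \<le> \<bar>s - s'\<bar> / 1" using a by (intro divide_left_mono) auto
  then have uu: "\<bar>u - u'\<bar> \<le> \<bar>s - s'\<bar>"
    unfolding u_def u'_def using state_step_lipschitz[of a s s'] a Cons.prems by auto
  have "word_prob (a # w) s - word_prob (a # w) s'
    = (digit_prob a s - digit_prob a s') * word_prob w u + digit_prob a s' * (word_prob w u - word_prob w u')"
    by (simp add: u_def u'_def algebra_simps)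
  then have "\<bar>word_prob (a # w) s - word_prob (a # w) s'\<bar>
    \<le> \<bar>digit_prob a s - digit_prob a s'\<bar> * \<bar>word_prob w u\<bar> + \<bar>digit_prob a s'\<bar> * \<bar>word_prob w u - word_prob w u'\<bar>"
    by (metis abs_mult abs_triangle_ineq)
  also have "\<dots> \<le> \<bar>s - s'\<bar> * 1 + 1 * (real (length w) * \<bar>s - s'\<bar>)"
  proof (intro add_mono mult_mono)
    show "\<bar>digit_prob a s - digit_prob a s'\<bar> \<le> \<bar>s - s'\<bar>"
      by (rule order.trans[OF digit_prob_lipschitz[OF a(1) Cons.prems(2,3)]]) simp
    show "\<bar>word_prob w u\<bar> \<le> 1" using word_prob_bounds[OF w u(1)] word_prob_le_1[OF w u(1)] by simp
    show "\<bar>digit_prob a s'\<bar> \<le> 1" using digit_prob_bounds[OF a(1) Cons.prems(3)] by simp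
    have "\<bar>word_prob w u - word_prob w u'\<bar> \<le> real (length w) * \<bar>u - u'\<bar>" using Cons.IH w u by simp
    also have "\<dots> \<le> real (length w) * \<bar>s - s'\<bar>" using uu by (intro mult_left_mono) auto
    finally show "\<bar>word_prob w u - word_prob w u'\<bar> \<le> real (length w) * \<bar>s - s'\<bar>" .
  qed auto
  finally show ?case by (simp add: algebra_simps)
qed simp

lemma word_avg_word_prob:
  "word_avg K k (word_prob w) s = (\<Sum>u\<in>words K k. word_prob (u @ w) s)"
  by (simp add: word_avg_def word_prob_append)

text \<open>The \<open>k\<close> digits in between make the chance \<open>S\<close> of reading
  \<open>t\<close> next almost independent of the starting parameter, so \<open>S\<close> is nearly
  at most its Gauss average. Discarding words with digits above \<open>K\<close> only lowers the
  sums, so an upper bound survives the cutoff.\<close>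

lemma gauss_mixing_upper:
  assumes K: "K \<ge> 1" and t: "\<forall>d\<in>set t. d > 0"
  shows "(\<Sum>u\<in>words K k. gauss_length (t @ u @ t))
    \<le> gauss_length t * (gauss_length t + ((7 / 8) ^ k * real (length t) + 8 / real K))"
proof -
  define S where "S = word_avg K k (word_prob t)"
  define \<epsilon> where "\<epsilon> = (7 / 8) ^ k * real (length t) + 8 / real K"
  have \<epsilon>: "\<epsilon> \<ge> 0" by (simp add: \<epsilon>_def)
  have osc: "S s \<le> S s' + \<epsilon>" if "s \<in> {0..1}" "s' \<in> {0..1}" for s s'
  proof -
    have "\<bar>S s - S s'\<bar> \<le> \<epsilon> * \<bar>s - s'\<bar>"
      unfolding S_def \<epsilon>_def
      by (rule word_avg_lipschitz[OF K])
         (use t that word_prob_lipschitz word_prob_bounds word_prob_le_1 in auto)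
    also have "\<dots> \<le> \<epsilon> * 1" using that \<epsilon> by (intro mult_left_mono) auto
    finally show ?thesis by linarith
  qed
  have pos: "\<forall>d\<in>set (u @ t). d > 0" "\<forall>d\<in>set (t @ u @ t). d > 0" if "u \<in> words K k" for u
    using t words_pos[OF that] by auto
  have int1: "((\<lambda>s. 1 / (1 + s)) has_integral ln (2::real)) {0..1}"
    using gauss_length_integral[of "[]"] by (simp add: gauss_length_Nil)
  \<comment> \<open>By \<open>osc\<close> the Gauss average of \<open>S\<close> is at least
    \<open>S s\<close> - \<epsilon>, while by invariance it is at most
    \<open>gauss_length t\<close>.\<close>
  have S_le: "S s \<le> gauss_length t + \<epsilon>" if s: "s \<in> {0..1}" for s
  proof -
    have "((\<lambda>s. \<Sum>u\<in>words K k. word_prob (u @ t) s / (1 + s)) has_integral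
        (\<Sum>u\<in>words K k. ln 2 * gauss_length (u @ t))) {0..1}"
      by (intro has_integral_sum finite_words gauss_length_integral pos)
    then have I: "((\<lambda>s. S s / (1 + s)) has_integral (\<Sum>u\<in>words K k. ln 2 * gauss_length (u @ t))) {0..1}"
      by (simp add: S_def word_avg_word_prob sum_divide_distrib)
    have "(S s - \<epsilon>) * ln 2 \<le> (\<Sum>u\<in>words K k. ln 2 * gauss_length (u @ t))"
    proof (rule has_integral_le[OF has_integral_mult_right[OF int1] I])
      fix s' :: real assume "s' \<in> {0..1}"
      then show "(S s - \<epsilon>) * (1 / (1 + s')) \<le> S s' / (1 + s')"
        using osc[OF s, of s'] by (simp add: divide_right_mono)
    qed
    also have "\<dots> = ln 2 * (\<Sum>u\<in>words K k. gauss_length (u @ t))" by (simp add: sum_distrib_left)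
    also have "\<dots> \<le> ln 2 * gauss_length t"
      by (intro mult_left_mono sum_gauss_length_prefix_le t) auto
    finally show ?thesis by (simp add: mult.commute)
  qed
  have "((\<lambda>s. \<Sum>u\<in>words K k. word_prob (t @ u @ t) s / (1 + s)) has_integral
      (\<Sum>u\<in>words K k. ln 2 * gauss_length (t @ u @ t))) {0..1}"
    by (intro has_integral_sum finite_words gauss_length_integral pos)
  moreover have "(\<Sum>u\<in>words K k. word_prob (t @ u @ t) s / (1 + s)) = word_prob t s / (1 + s) * S (word_state t s)" for s
    by (simp add: S_def word_avg_word_prob word_prob_append[of t] sum_distrib_left sum_divide_distrib)
  ultimately have I: "((\<lambda>s. word_prob t s / (1 + s) * S (word_state t s)) has_integral
      (\<Sum>u\<in>words K k. ln 2 * gauss_length (t @ u @ t))) {0..1}" by simp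
  have "(\<Sum>u\<in>words K k. ln 2 * gauss_length (t @ u @ t)) \<le> ln 2 * gauss_length t * (gauss_length t + \<epsilon>)"
  proof (rule has_integral_le[OF I has_integral_mult_left[OF gauss_length_integral[OF t]]])
    fix s :: real assume s: "s \<in> {0..1}"
    show "word_prob t s / (1 + s) * S (word_state t s) \<le> word_prob t s / (1 + s) * (gauss_length t + \<epsilon>)"
      using word_prob_bounds[OF t s] s by (intro mult_left_mono S_le word_state_unit t s) auto
  qed
  then have "ln 2 * (\<Sum>u\<in>words K k. gauss_length (t @ u @ t)) \<le> ln 2 * (gauss_length t * (gauss_length t + \<epsilon>))"
    by (simp add: sum_distrib_left mult.assoc)
  then show ?thesis by (simp add: \<epsilon>_def)
qed

section \<open>Asymptotic means along arithmetic progressions\<close>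

text \<open>The limit superior of the averages of \<open>f\<close> is at most \<open>v\<close>. A
  one-sided notion suits pair correlations, for which only upper bounds are derived.\<close>

definition mean_le :: "(nat \<Rightarrow> real) \<Rightarrow> real \<Rightarrow> bool" where
  "mean_le f v \<longleftrightarrow> (\<forall>e>0. \<forall>\<^sub>F M in sequentially. (\<Sum>j<M. f j) \<le> (v + e) * real M)"

lemma eventually_le_linear:
  fixes b e :: real
  assumes "e > 0"
  shows "\<forall>\<^sub>F M in sequentially. b \<le> e * real M"
proof -
  obtain M0 where M0: "b / e \<le> real M0" using real_arch_simple by blast
  show ?thesis
    using eventually_ge_at_top[of M0]
  proof eventually_elim
    case (elim M)
    then have "b / e \<le> real M" using M0 by linarith
    then show ?case using assms by (simp add: divide_simps mult.commute)
  qed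
qed

lemma mean_le_mono:
  assumes "mean_le g w" "\<And>j. f j \<le> g j" "w \<le> v"
  shows "mean_le f v"
  unfolding mean_le_def
proof (intro allI impI)
  fix e :: real assume "e > 0"
  with assms(1) have "\<forall>\<^sub>F M in sequentially. (\<Sum>j<M. g j) \<le> (w + e) * real M"
    by (simp add: mean_le_def)
  then show "\<forall>\<^sub>F M in sequentially. (\<Sum>j<M. f j) \<le> (v + e) * real M"
  proof eventually_elim
    case (elim M)
    have "(\<Sum>j<M. f j) \<le> (\<Sum>j<M. g j)" by (intro sum_mono assms)
    moreover have "(w + e) * real M \<le> (v + e) * real M" using assms(3) by (intro mult_right_mono) auto
    ultimately show ?case using elim by linarith
  qed
qed

lemma mean_le_const: "mean_le (\<lambda>_. c) c"
  by (auto simp: mean_le_def algebra_simps)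

lemma mean_le_add:
  assumes "mean_le f v" "mean_le g w"
  shows "mean_le (\<lambda>j. f j + g j) (v + w)"
  unfolding mean_le_def
proof (intro allI impI)
  fix e :: real assume "e > 0"
  then have "e / 2 > 0" by simp
  with assms have "\<forall>\<^sub>F M in sequentially. (\<Sum>j<M. f j) \<le> (v + e / 2) * real M"
    and "\<forall>\<^sub>F M in sequentially. (\<Sum>j<M. g j) \<le> (w + e / 2) * real M"
    unfolding mean_le_def by blast+
  then show "\<forall>\<^sub>F M in sequentially. (\<Sum>j<M. f j + g j) \<le> (v + w + e) * real M"
    by eventually_elim (simp add: sum.distrib algebra_simps)
qed

lemma mean_le_sum:
  assumes "finite I" "\<And>i. i \<in> I \<Longrightarrow> mean_le (f i) (v i)"
  shows "mean_le (\<lambda>j. \<Sum>i\<in>I. f i j) (\<Sum>i\<in>I. v i)"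
  using assms
proof (induction I rule: finite_induct)
  case empty
  then show ?case using mean_le_const[of 0] by simp
next
  case (insert i I)
  then show ?case using mean_le_add[of "f i" "v i"] by simp
qed

lemma mean_le_cmult:
  assumes "mean_le f v" "c \<ge> 0"
  shows "mean_le (\<lambda>j. c * f j) (c * v)"
proof (cases "c = 0")
  case True
  then show ?thesis using mean_le_const[of 0] by simp
next
  case False
  then have c: "c > 0" using assms(2) by simp
  show ?thesis
    unfolding mean_le_def
  proof (intro allI impI)
    fix e :: real assume "e > 0"
    then have "e / c > 0" using c by simp
    with assms(1) have "\<forall>\<^sub>F M in sequentially. (\<Sum>j<M. f j) \<le> (v + e / c) * real M"
      unfolding mean_le_def by blast
    then show "\<forall>\<^sub>F M in sequentially. (\<Sum>j<M. c * f j) \<le> (c * v + e) * real M"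
    proof eventually_elim
      case (elim M)
      then have "c * (\<Sum>j<M. f j) \<le> c * ((v + e / c) * real M)" using c by (intro mult_left_mono) auto
      also have "\<dots> = (c * v + e) * real M" using c by (simp add: algebra_simps)
      finally show ?case by (simp add: sum_distrib_left)
    qed
  qed
qed

text \<open>Each unit shift drops one term of the sum and adds another.\<close>

lemma sum_shift_diff:
  fixes f :: "nat \<Rightarrow> real"
  assumes "\<And>j. \<bar>f j\<bar> \<le> B"
  shows "\<bar>(\<Sum>j<M. f (j + c)) - (\<Sum>j<M. f j)\<bar> \<le> 2 * B * real c"
proof (induction c)
  case (Suc c)
  have "(\<Sum>j<M. f (j + Suc c)) = (\<Sum>j<M. f (j + c)) + f (M + c) - f c"
    by (induction M) auto
  then show ?case using Suc assms[of "M + c"] assms[of c] by (simp add: algebra_simps)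
qed simp

lemma mean_le_shift:
  assumes "mean_le f v" "\<And>j. \<bar>f j\<bar> \<le> B"
  shows "mean_le (\<lambda>j. f (j + c)) v"
  unfolding mean_le_def
proof (intro allI impI)
  fix e :: real assume "e > 0"
  then have e: "e / 2 > 0" by simp
  with assms(1) have "\<forall>\<^sub>F M in sequentially. (\<Sum>j<M. f j) \<le> (v + e / 2) * real M"
    unfolding mean_le_def by blast
  then show "\<forall>\<^sub>F M in sequentially. (\<Sum>j<M. f (j + c)) \<le> (v + e) * real M"
    using eventually_le_linear[OF e, of "2 * B * real c"]
  proof eventually_elim
    case (elim M)
    moreover have "(v + e) * real M = (v + e / 2) * real M + e / 2 * real M"
      by (simp add: algebra_simps)
    ultimately show ?case using sum_shift_diff[of f B c M, OF assms(2)] by linarith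
  qed
qed

lemma mean_le_limit:
  assumes "\<And>\<delta>. \<delta> > 0 \<Longrightarrow> mean_le f (v + \<delta>)"
  shows "mean_le f v"
  unfolding mean_le_def
proof (intro allI impI)
  fix e :: real assume "e > 0"
  then have e: "e / 2 > 0" by simp
  with assms[OF e] show "\<forall>\<^sub>F M in sequentially. (\<Sum>j<M. f j) \<le> (v + e) * real M"
    unfolding mean_le_def by (metis add.assoc field_sum_of_halves)
qed

lemma tendsto_mean_le:
  assumes "(\<lambda>M. (\<Sum>j<M. f j) / real M) \<longlonglongrightarrow> v"
  shows "mean_le f v"
  unfolding mean_le_def
proof (intro allI impI)
  fix e :: real assume "e > 0"
  then have "\<forall>\<^sub>F M in sequentially. (\<Sum>j<M. f j) / real M < v + e"
    by (intro order_tendstoD(2)[OF assms]) simp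
  then show "\<forall>\<^sub>F M in sequentially. (\<Sum>j<M. f j) \<le> (v + e) * real M"
    using eventually_gt_at_top[of 0] by eventually_elim (simp add: divide_simps)
qed

section \<open>From all positions to the multiples of \<open>m\<close>\<close>

text \<open>A van der Corput argument: \<open>D j\<close> adds \<open>L\<close> deviations spaced
  \<open>c\<close> apart. Its mean square is at most \<open>L\<close> from the diagonal plus L^2
  \<delta> from the correlations, which is small against L^2.\<close>

lemma tendsto_mean_progression:
  fixes h :: "nat \<Rightarrow> real"
  assumes m: "m \<ge> 1" and g: "g \<in> {0..1}"
    and h: "\<And>j. h j \<in> {0..1}"
    and mean: "(\<lambda>M. (\<Sum>j<M. h j) / real M) \<longlonglongrightarrow> g"
    and mix: "\<And>\<delta>. \<delta> > 0 \<Longrightarrow> \<exists>r\<ge>1. \<forall>k\<ge>r. mean_le (\<lambda>j. h j * h (j + m * k)) (g ^ 2 + \<delta>)"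
  shows "(\<lambda>N. (\<Sum>i<N. h (m * i)) / real N) \<longlonglongrightarrow> g"
proof (rule LIMSEQ_I)
  fix \<eta> :: real assume \<eta>: "\<eta> > 0"
  \<comment> \<open>Chosen so that 3 L^2 \<delta> m = (L \<eta> / 2)^2 in \<open>sq\<close>; the 3
    covers the diagonal, the correlations and the slack 1 in \<open>ev\<close>.\<close>
  define \<delta> where "\<delta> = \<eta> ^ 2 / (12 * real m)"
  have \<delta>: "\<delta> > 0" using \<eta> m by (simp add: \<delta>_def)
  then obtain r where r: "r \<ge> 1" "\<And>k. k \<ge> r \<Longrightarrow> mean_le (\<lambda>j. h j * h (j + m * k)) (g ^ 2 + \<delta>)"
    using mix by blast
  \<comment> \<open>With L \<delta> \<ge> 1 the diagonal contribution \<open>L\<close> is at most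
    L^2 \<delta>.\<close>
  obtain L :: nat where L: "1 / \<delta> < real L" using reals_Archimedean2 by blast
  have L\<delta>: "1 \<le> real L * \<delta>" using L \<delta> by (simp add: divide_simps)
  have "0 < real L" using L \<delta> by (meson less_trans zero_less_divide_1_iff)
  then have L0: "real L \<ge> 1" by simp
  \<comment> \<open>A multiple of \<open>m\<close>, so that the shifts stay in the progression, and
    \<open>r\<close> of its steps, so that distinct shifts are far enough apart for
    \<open>r(2)\<close>.\<close>
  define c where "c = m * r"
  define D where "D j = (\<Sum>l<L. h (j + c * l) - g)" for j
  have le1: "\<bar>h i - g\<bar> \<le> 1" for i using h[of i] g by (auto simp: abs_le_iff)
  have h_mean: "mean_le (\<lambda>j. - h (j + d)) (- g)" for d
  proof (rule mean_le_shift)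
    show "mean_le (\<lambda>j. - h j) (- g)"
      by (rule tendsto_mean_le) (use tendsto_minus[OF mean] in \<open>simp add: sum_negf\<close>)
    show "\<bar>- h j\<bar> \<le> 1" for j using h[of j] by simp
  qed
  have off: "mean_le (\<lambda>j. (h (j + c * l) - g) * (h (j + c * l') - g)) \<delta>" if "l < l'" for l l'
  proof -
    define k where "k = l' - l"
    then have k: "l' = l + k" "k \<ge> 1" using that by auto
    have "mean_le (\<lambda>j. h (j + c * l) * h (j + c * l + m * (r * k))) (g ^ 2 + \<delta>)"
    proof (rule mean_le_shift)
      show "mean_le (\<lambda>j. h j * h (j + m * (r * k))) (g ^ 2 + \<delta>)" using r(2)[of "r * k"] k by simp
      show "\<bar>h j * h (j + m * (r * k))\<bar> \<le> 1" for j
        using h[of j] h[of "j + m * (r * k)"] by (simp add: mult_le_one)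
    qed
    moreover have "j + c * l + m * (r * k) = j + c * l'" for j by (simp add: c_def k algebra_simps)
    ultimately have "mean_le (\<lambda>j. h (j + c * l) * h (j + c * l')) (g ^ 2 + \<delta>)" by simp
    moreover have "mean_le (\<lambda>j. g * - h (j + d)) (g * - g)" for d
      using mean_le_cmult[OF h_mean, of g d] g by simp
    \<comment> \<open>The product is expanded; the cross terms have means at most -g^2 each, so
      everything but \<delta> cancels.\<close>
    ultimately have "mean_le (\<lambda>j. h (j + c * l) * h (j + c * l') + g * - h (j + c * l)
        + g * - h (j + c * l') + g ^ 2) (g ^ 2 + \<delta> + g * - g + g * - g + g ^ 2)"
      by (intro mean_le_add mean_le_const)
    then show ?thesis by (rule mean_le_mono) (simp_all add: power2_eq_square algebra_simps)
  qed
  have pair: "mean_le (\<lambda>j. (h (j + c * l) - g) * (h (j + c * l') - g)) ((if l = l' then 1 else 0) + \<delta>)" for l l'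
  proof (cases l l' rule: linorder_cases)
    case less
    then show ?thesis using off by simp
  next
    case equal
    have "(h (j + c * l) - g) * (h (j + c * l') - g) \<le> 1" for j
      using equal mult_le_one[OF le1 abs_ge_zero le1, of "j + c * l" "j + c * l"] by simp
    then show ?thesis using mean_le_mono[OF mean_le_const[of 1]] \<delta> equal by simp
  next
    case greater
    then show ?thesis using off[of l' l] by (simp add: mult.commute)
  qed
  have "mean_le (\<lambda>j. \<Sum>l<L. \<Sum>l'<L. (h (j + c * l) - g) * (h (j + c * l') - g))
      (\<Sum>l<L. \<Sum>l'<L. (if l = l' then 1 else 0) + \<delta>)"
    by (intro mean_le_sum pair) auto
  then have D_mean: "mean_le (\<lambda>j. D j ^ 2) (real L + real L ^ 2 * \<delta>)"
    by (rule mean_le_mono)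
      (simp_all add: D_def power2_eq_square sum_product sum.distrib sum.delta algebra_simps)
  have sq: "\<bar>\<Sum>i<N. D (m * i)\<bar> \<le> real N * real L * (\<eta> / 2)"
    if N: "(\<Sum>j<m * N. D j ^ 2) \<le> (real L + real L ^ 2 * \<delta> + 1) * real (m * N)" for N
  proof -
    have "(\<Sum>i<N. D (m * i) ^ 2) = (\<Sum>j\<in>(\<lambda>i. m * i) ` {..<N}. D j ^ 2)"
      using m by (subst sum.reindex) (auto simp: inj_on_def)
    also have "\<dots> \<le> (\<Sum>j<m * N. D j ^ 2)"
      using m by (intro sum_mono2) auto
    also have "\<dots> \<le> (3 * real L ^ 2 * \<delta>) * real (m * N)"
    proof (rule order.trans[OF N mult_right_mono])
      have "real L \<le> real L ^ 2 * \<delta>"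
        using mult_left_mono[OF L\<delta>, of "real L"] by (simp add: power2_eq_square mult.assoc)
      then show "real L + real L ^ 2 * \<delta> + 1 \<le> 3 * real L ^ 2 * \<delta>"
        using L0 by linarith
    qed simp
    also have "\<dots> = real N * (real L * (\<eta> / 2)) ^ 2"
      using m by (simp add: \<delta>_def power_mult_distrib power_divide)
    finally have "(\<Sum>i<N. D (m * i) ^ 2) \<le> real N * (real L * (\<eta> / 2)) ^ 2" .
    then have "(\<Sum>i<N. D (m * i) ^ 2) * real N \<le> real N * (real L * (\<eta> / 2)) ^ 2 * real N"
      by (rule mult_right_mono) simp
    moreover have "(\<Sum>i<N. D (m * i)) ^ 2 \<le> (\<Sum>i<N. D (m * i) ^ 2) * real N"
      using sum_squared_le_sum_of_squares[of "\<lambda>i. D (m * i)" "{..<N}"] by (simp add: mult.commute)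
    ultimately have "(\<Sum>i<N. D (m * i)) ^ 2 \<le> (real N * real L * (\<eta> / 2)) ^ 2"
      by (simp add: power_mult_distrib power2_eq_square mult_ac)
    then show ?thesis using \<eta> by (simp add: abs_le_square_iff[symmetric])
  qed
  \<comment> \<open>Shifts by r l within the progression change a sum of \<open>N\<close> deviations
    by a bounded amount, so the sum of the \<open>D (m * i)\<close> is \<open>L\<close> times the
    deviation sought, up to an error independent of \<open>N\<close>.\<close>
  have avg: "\<bar>real L * (\<Sum>i<N. h (m * i) - g) - (\<Sum>i<N. D (m * i))\<bar> \<le> 2 * real r * real L * real L" for N
  proof -
    have "(\<Sum>i<N. D (m * i)) = (\<Sum>i<N. \<Sum>l<L. h (m * (i + r * l)) - g)"
      by (simp add: D_def c_def algebra_simps)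
    also have "\<dots> = (\<Sum>l<L. \<Sum>i<N. h (m * (i + r * l)) - g)" by (rule sum.swap)
    finally have "real L * (\<Sum>i<N. h (m * i) - g) - (\<Sum>i<N. D (m * i))
      = (\<Sum>l<L. (\<Sum>i<N. h (m * i) - g) - (\<Sum>i<N. h (m * (i + r * l)) - g))"
      by (simp add: sum_subtractf right_diff_distrib)
    also have "\<bar>\<dots>\<bar> \<le> (\<Sum>l<L. 2 * real r * real L)"
    proof (rule order.trans[OF sum_abs sum_mono])
      fix l assume "l \<in> {..<L}"
      then have "real r * real l \<le> real r * real L" by (intro mult_left_mono) auto
      then show "\<bar>(\<Sum>i<N. h (m * i) - g) - (\<Sum>i<N. h (m * (i + r * l)) - g)\<bar> \<le> 2 * real r * real L"
        using sum_shift_diff[of "\<lambda>i. h (m * i) - g" 1 "r * l" N, OF le1] by simp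
    qed
    finally show ?thesis by (simp add: mult_ac)
  qed
  have ev: "\<forall>\<^sub>F M in sequentially. (\<Sum>j<M. D j ^ 2) \<le> (real L + real L ^ 2 * \<delta> + 1) * real M"
    using D_mean unfolding mean_le_def by simp
  have "filterlim (\<lambda>N. m * N) at_top sequentially"
    using m by (intro filterlim_subseq) (simp add: strict_mono_def)
  from eventually_compose_filterlim[OF ev this]
  have ev': "\<forall>\<^sub>F N in sequentially. (\<Sum>j<m * N. D j ^ 2) \<le> (real L + real L ^ 2 * \<delta> + 1) * real (m * N)" .
  have \<eta>4: "\<eta> / 4 > 0" using \<eta> by simp
  have "\<forall>\<^sub>F N in sequentially. norm ((\<Sum>i<N. h (m * i)) / real N - g) < \<eta>"
    using ev' eventually_le_linear[OF \<eta>4, of "2 * real r * real L"] eventually_gt_at_top[of 0]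
  proof eventually_elim
    case (elim N)
    have "\<bar>real L * (\<Sum>i<N. h (m * i) - g)\<bar> \<le> real N * real L * (\<eta> / 2) + 2 * real r * real L * real L"
      using sq[OF elim(1)] avg[of N] by linarith
    then have "real L * \<bar>\<Sum>i<N. h (m * i) - g\<bar> \<le> real L * (real N * (\<eta> / 2) + 2 * real r * real L)"
      by (simp add: abs_mult algebra_simps)
    then have "\<bar>\<Sum>i<N. h (m * i) - g\<bar> \<le> real N * (\<eta> / 2) + 2 * real r * real L"
      using L0 by (subst (asm) mult_le_cancel_left_pos) auto
    also have "\<dots> \<le> real N * (3 / 4 * \<eta>)" using elim by (simp add: algebra_simps)
    also have "\<dots> < real N * \<eta>" using elim \<eta> by simp
    finally have "\<bar>\<Sum>i<N. h (m * i) - g\<bar> < real N * \<eta>" .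
    moreover have "(\<Sum>i<N. h (m * i)) / real N - g = (\<Sum>i<N. h (m * i) - g) / real N"
      using elim by (simp add: sum_subtractf divide_simps)
    ultimately show ?case using elim by (simp add: divide_simps mult.commute)
  qed
  then show "\<exists>no. \<forall>n\<ge>no. norm ((\<Sum>i<n. h (m * i)) / real n - g) < \<eta>"
    by (simp add: eventually_sequentially)
qed

section \<open>Occurrences of words in the digit sequence\<close>

lemma gauss_length_le_1:
  assumes "\<forall>d\<in>set w. d > 0"
  shows "gauss_length w \<le> 1"
proof -
  have "0 \<le> ln (1 + cf_branch w z) \<and> ln (1 + cf_branch w z) \<le> ln 2" if "z \<in> {0..1}" for z
    using cf_branch_unit[OF assms that] by simp
  from this[of 0] this[of 1]
  have "\<bar>ln (1 + cf_branch w 1) - ln (1 + cf_branch w 0)\<bar> \<le> ln 2" by auto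
  then show ?thesis by (simp add: gauss_length_def)
qed

section \<open>Frequencies of single and paired occurrences\<close>

definition occurs :: "(nat \<Rightarrow> nat) \<Rightarrow> nat list \<Rightarrow> nat \<Rightarrow> bool" where
  "occurs b w j \<longleftrightarrow> (\<forall>i<length w. b (j + i) = w ! i)"

lemma occurs_append:
  "occurs b (v @ w) j \<longleftrightarrow> occurs b v j \<and> occurs b w (j + length v)"
proof -
  have "(\<forall>i<k + l. P i) \<longleftrightarrow> (\<forall>i<k. P i) \<and> (\<forall>i<l. P (k + i))" for k l :: nat and P
  proof (intro iffI conjI allI impI; (elim conjE)?)
    fix i assume *: "\<forall>i<k. P i" "\<forall>i<l. P (k + i)" and "i < k + l"
    then show "P i" using *(2)[rule_format, of "i - k"] by (cases "i < k") auto
  qed auto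
  from this[of "length v" "length w" "\<lambda>i. b (j + i) = (v @ w) ! i"]
  show ?thesis by (simp add: occurs_def nth_append add.assoc)
qed

lemma occurs_singleton: "occurs b [a] j \<longleftrightarrow> b j = a"
  by (simp add: occurs_def)

text \<open>Either the gap between the two occurrences is a word with digits at most
  \<open>K\<close>, or some digit in it exceeds \<open>K\<close>. As digits are positive, one minus
  the indicators of 1, ..., \<open>K\<close> detects a large digit by finitely many words of known
  frequency.\<close>

lemma pair_occurrence_le:
  assumes pos: "\<And>i. b i > 0"
  shows "of_bool (occurs b t j) * of_bool (occurs b t (j + length t + q))
    \<le> (\<Sum>u\<in>words K q. of_bool (occurs b (t @ u @ t) j))
      + (\<Sum>p<q. 1 + (\<Sum>a=1..K. - (of_bool (occurs b [a] (j + (length t + p))) :: real)))"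
proof -
  define s where "s = j + length t"
  define A where "A = (\<Sum>u\<in>words K q. of_bool (occurs b (t @ u @ t) j) :: real)"
  define R where "R p = 1 + (\<Sum>a=1..K. - (of_bool (occurs b [a] (s + p)) :: real))" for p
  have A: "0 \<le> A" unfolding A_def by (intro sum_nonneg) simp
  have R: "0 \<le> R p" for p
    by (simp add: R_def occurs_singleton of_bool_def sum_negf sum.delta)
  then have sum_R: "0 \<le> (\<Sum>p<q. R p)" by (intro sum_nonneg)
  have "of_bool (occurs b t j) * of_bool (occurs b t (s + q)) \<le> A + (\<Sum>p<q. R p)"
  proof (cases "occurs b t j \<and> occurs b t (s + q)")
    case False
    then have "of_bool (occurs b t j) * of_bool (occurs b t (s + q)) = (0::real)" by auto
    then show ?thesis using A sum_R by linarith
  next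
    case occ: True
    have "1 \<le> A + (\<Sum>p<q. R p)"
    proof (cases "\<forall>p<q. b (s + p) \<le> K")
      case True
      define u where "u = map (\<lambda>p. b (s + p)) [0..<q]"
      have u: "u \<in> words K q" using True pos by (auto simp: u_def words_def Suc_le_eq)
      have "occurs b (t @ u @ t) j"
        using occ by (simp add: occurs_append s_def[symmetric]) (simp add: occurs_def u_def)
      then have "(1::real) \<le> of_bool (occurs b (t @ u @ t) j)" by simp
      also have "\<dots> \<le> A"
        unfolding A_def by (rule member_le_sum[OF u]) (simp_all add: finite_words)
      finally show ?thesis using sum_R by linarith
    next
      case False
      then obtain p where p: "p < q" "b (s + p) > K" by auto
      have "(\<Sum>a=1..K. - (of_bool (occurs b [a] (s + p)) :: real)) = 0"
        using p by (intro sum.neutral) (auto simp: occurs_singleton)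
      then have "1 = R p" by (simp add: R_def)
      also have "\<dots> \<le> (\<Sum>p<q. R p)"
        by (rule member_le_sum) (use p R in auto)
      finally show ?thesis using A by linarith
    qed
    then show ?thesis using occ by simp
  qed
  then show ?thesis by (simp only: A_def R_def s_def add.assoc)
qed

text \<open>For a fixed gap \<open>q\<close> the cutoff \<open>K\<close> is sent to infinity first,
  which leaves the error (7/8)^q m; only then does the gap grow.\<close>

lemma normal_mixing:
  assumes pos: "\<And>i. b i > 0" and t: "t \<noteq> []" "\<forall>d\<in>set t. d > 0"
    and freq: "\<And>w. w \<noteq> [] \<Longrightarrow> \<forall>d\<in>set w. d > 0 \<Longrightarrow>
      (\<lambda>M. (\<Sum>j<M. of_bool (occurs b w j)) / real M) \<longlonglongrightarrow> gauss_length w"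
    and \<delta>: "\<delta> > 0"
  shows "\<exists>r\<ge>1. \<forall>k\<ge>r. mean_le (\<lambda>j. of_bool (occurs b t j) * of_bool (occurs b t (j + length t * k)))
    (gauss_length t ^ 2 + \<delta>)"
proof -
  define m where "m = length t"
  have m: "m \<ge> 1" using t by (cases t) (auto simp: m_def)
  have bound: "mean_le (\<lambda>j. of_bool (occurs b t j) * of_bool (occurs b t (j + length t + q)))
      (gauss_length t ^ 2 + (7 / 8) ^ q * real m)" for q
  proof (rule mean_le_limit)
    fix e :: real assume e: "e > 0"
    \<comment> \<open>The error 8 / K stems from mixing, and 2 / K from large digits at each of the
      \<open>q\<close> positions in the gap.\<close>
    obtain K' :: nat where K': "(8 + 2 * real q) / e < real K'" using reals_Archimedean2 by blast
    define K where "K = Suc K'"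
    have K: "K \<ge> 1" "(8 + 2 * real q) / real K \<le> e"
      using K' e by (auto simp: K_def divide_simps algebra_simps)
    let ?G = "(\<Sum>u\<in>words K q. gauss_length (t @ u @ t)) + (\<Sum>p<q. 1 + (\<Sum>a=1..K. - gauss_length [a]))"
    have "mean_le (\<lambda>j. (\<Sum>u\<in>words K q. of_bool (occurs b (t @ u @ t) j))
      + (\<Sum>p<q. 1 + (\<Sum>a=1..K. - of_bool (occurs b [a] (j + (length t + p)))))) ?G"
    proof (intro mean_le_add mean_le_sum finite_words finite_lessThan finite_atLeastAtMost mean_le_const)
      fix u assume "u \<in> words K q"
      then have "\<forall>d\<in>set (t @ u @ t). d > 0" using t words_pos by auto
      then show "mean_le (\<lambda>j. of_bool (occurs b (t @ u @ t) j)) (gauss_length (t @ u @ t))"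
        using t by (intro tendsto_mean_le freq) auto
    next
      fix p a assume a: "a \<in> {1..K}"
      show "mean_le (\<lambda>j. - of_bool (occurs b [a] (j + (length t + p)))) (- gauss_length [a])"
      proof (rule mean_le_shift)
        have "(\<lambda>M. (\<Sum>j<M. of_bool (occurs b [a] j)) / real M) \<longlonglongrightarrow> gauss_length [a]"
          using a by (intro freq) auto
        from tendsto_minus[OF this] show "mean_le (\<lambda>j. - of_bool (occurs b [a] j)) (- gauss_length [a])"
          by (intro tendsto_mean_le) (simp add: sum_negf)
        show "\<bar>- of_bool (occurs b [a] j)\<bar> \<le> (1::real)" for j by simp
      qed
    qed
    moreover have "?G \<le> gauss_length t ^ 2 + (7 / 8) ^ q * real m + e"
    proof -
      define x where "x = (7 / 8) ^ q * real m + 8 / real K"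
      have "x \<ge> 0" by (simp add: x_def)
      have "(\<Sum>u\<in>words K q. gauss_length (t @ u @ t)) \<le> gauss_length t * (gauss_length t + x)"
        unfolding x_def m_def by (rule gauss_mixing_upper[OF K(1) t(2)])
      also have "\<dots> \<le> gauss_length t ^ 2 + x"
        using mult_right_mono[OF gauss_length_le_1[OF t(2)] \<open>x \<ge> 0\<close>]
        by (simp add: power2_eq_square distrib_left)
      finally have 1: "(\<Sum>u\<in>words K q. gauss_length (t @ u @ t)) \<le> gauss_length t ^ 2 + x" .
      have "(\<Sum>p<q. 1 + (\<Sum>a=1..K. - gauss_length [a])) \<le> (\<Sum>p<q. 2 / real K)"
        using sum_gauss_length_digit[of K] K by (intro sum_mono) (simp add: sum_negf)
      also have "\<dots> = 2 * real q / real K" by simp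
      finally have 2: "(\<Sum>p<q. 1 + (\<Sum>a=1..K. - gauss_length [a])) \<le> 2 * real q / real K" .
      have "8 / real K + 2 * real q / real K \<le> e" using K by (simp add: add_divide_distrib)
      with 1 2 show ?thesis unfolding x_def by linarith
    qed
    ultimately show "mean_le (\<lambda>j. of_bool (occurs b t j) * of_bool (occurs b t (j + length t + q)))
        (gauss_length t ^ 2 + (7 / 8) ^ q * real m + e)"
      by (rule mean_le_mono[OF _ pair_occurrence_le[OF pos]])
  qed
  have "(\<lambda>q. (7 / 8) ^ q * real m) \<longlonglongrightarrow> 0 * real m"
    by (intro tendsto_mult LIMSEQ_power_zero tendsto_const) simp
  then have "\<forall>\<^sub>F q in sequentially. (7 / 8) ^ q * real m < \<delta>"
    using \<delta> by (intro order_tendstoD(2)) auto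
  then obtain q0 where q0: "\<And>q. q \<ge> q0 \<Longrightarrow> (7 / 8) ^ q * real m < \<delta>"
    by (auto simp: eventually_sequentially)
  have "mean_le (\<lambda>j. of_bool (occurs b t j) * of_bool (occurs b t (j + length t * k)))
      (gauss_length t ^ 2 + \<delta>)" if k: "k \<ge> Suc q0" for k
  proof -
    \<comment> \<open>The occurrences start m k apart and the first has length \<open>m\<close>, so
      m (k - 1) digits lie between them, at least q0 for k \<ge> q0 + 1.\<close>
    define q where "q = m * (k - 1)"
    have "k - 1 \<le> q" using m by (simp add: q_def)
    then have "q \<ge> q0" using k by simp
    moreover have "length t + q = length t * k"
      using k by (cases k) (auto simp: q_def m_def)
    ultimately show ?thesis
      using mean_le_mono[OF bound[of q], of _ "gauss_length t ^ 2 + \<delta>"] q0[of q]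
      by (simp add: add.assoc)
  qed
  then show ?thesis by (intro exI[of _ "Suc q0"]) auto
qed

theorem theorem4p1:
  fixes x :: real
  assumes "x \<in> {0<..<1}" and "x \<notin> \<rat>"
    and normal: "\<And>(k::nat) (s::nat list).
      k \<ge> 1 \<Longrightarrow> length s = k \<Longrightarrow> (\<forall>d\<in>set s. d > 0) \<Longrightarrow>
      (\<lambda>n. real (card {i::nat. i \<le> n \<and> (gauss_map ^^ i) x \<in> cylinder s}) / real n)
        \<longlonglongrightarrow> measure gauss_measure (cylinder s)"
  shows "\<forall>(t::nat list) (m::nat). t \<noteq> [] \<longrightarrow> (\<forall>d\<in>set t. d > 0) \<longrightarrow> m = length t \<longrightarrow>
    (\<lambda>n. real (card {i::nat. real i \<le> real n / real m \<and> (gauss_map ^^ (m * i)) x \<in> cylinder t})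
          / (real n / real m))
      \<longlonglongrightarrow> measure gauss_measure (cylinder t)"
proof (intro allI impI)
  fix t :: "nat list" and m :: nat
  assume t: "t \<noteq> []" "\<forall>d\<in>set t. d > 0" and m: "m = length t"
  have m1: "m \<ge> 1" using t m by (cases t) auto
  define b where "b i = gauss_digit ((gauss_map ^^ i) x)" for i
  have x: "x \<in> {0<..<1} - \<rat>" using assms by simp
  have iter: "(gauss_map ^^ i) x \<in> {0<..<1} - \<rat>" for i by (rule irrational_gauss_iter[OF x])
  have pos: "b i > 0" for i unfolding b_def by (rule irrational_gauss(1)[OF iter])
  have cyl: "(gauss_map ^^ j) x \<in> cylinder w \<longleftrightarrow> occurs b w j" for j w
    unfolding irrational_in_cylinder_iff[OF iter] occurs_def b_def
    by (simp add: funpow_add[symmetric, THEN fun_cong, unfolded comp_def] add.commute)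
  have count: "real (card {i. i < N \<and> P i}) = (\<Sum>i<N. of_bool (P i))" for N :: nat and P
    by (simp add: of_bool_def sum.If_cases) (auto intro: arg_cong[of _ _ card])
  have freq: "(\<lambda>M. (\<Sum>j<M. of_bool (occurs b w j)) / real M) \<longlonglongrightarrow> gauss_length w"
    if w: "w \<noteq> []" "\<forall>d\<in>set w. d > 0" for w
  proof -
    have "length w \<ge> 1" using w by (cases w) auto
    from normal[OF this refl w(2)]
    have lim: "(\<lambda>n. (\<Sum>j<Suc n. of_bool (occurs b w j)) / real n) \<longlonglongrightarrow> gauss_length w"
      by (simp only: measure_cylinder[OF w(2)] cyl less_Suc_eq_le[symmetric] count)
    \<comment> \<open>The hypothesis counts the n + 1 positions 0, ..., n but divides by n; the last
      position is negligible.\<close>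
    have "(\<lambda>n. of_bool (occurs b w n) / real n) \<longlonglongrightarrow> 0"
      by (rule Lim_null_comparison[OF always_eventually lim_1_over_n]) simp
    from tendsto_diff[OF lim this] show ?thesis by (simp add: add_divide_distrib)
  qed
  have prog: "(\<lambda>N. (\<Sum>i<N. of_bool (occurs b t (m * i))) / real N) \<longlonglongrightarrow> gauss_length t"
  proof (rule tendsto_mean_progression[OF m1])
    show "gauss_length t \<in> {0..1}" using gauss_length_nonneg gauss_length_le_1[OF t(2)] by simp
    show "\<exists>r\<ge>1. \<forall>k\<ge>r. mean_le (\<lambda>j. of_bool (occurs b t j) * of_bool (occurs b t (j + m * k)))
        (gauss_length t ^ 2 + \<delta>)" if "\<delta> > 0" for \<delta>
      unfolding m by (rule normal_mixing[OF pos t freq that])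
  qed (use freq[OF t] in auto)
  \<comment> \<open>The number of i with 0 \<le> i \<le> n / m, the endpoint 0 included.\<close>
  define N where "N n = Suc (n div m)" for n
  have le_iff: "real i \<le> real n / real m \<longleftrightarrow> i < N n" for i n
  proof -
    have "real i \<le> real n / real m \<longleftrightarrow> i * m \<le> n"
      using m1 by (simp add: pos_le_divide_eq flip: of_nat_mult)
    then show ?thesis using m1 by (simp add: N_def less_Suc_eq_le less_eq_div_iff_mult_less_eq)
  qed
  have N_lim: "filterlim N at_top sequentially"
    unfolding filterlim_at_top
  proof
    fix Z
    show "\<forall>\<^sub>F n in sequentially. Z \<le> N n"
      using eventually_ge_at_top[of "Z * m"]
    proof eventually_elim
      case (elim n)
      then have "Z \<le> n div m" using m1 by (simp add: less_eq_div_iff_mult_less_eq)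
      then show ?case by (simp add: N_def)
    qed
  qed
  \<comment> \<open>m \<open>N n\<close> lies between n and n + m.\<close>
  have ratio: "(\<lambda>n. real (N n) / (real n / real m)) \<longlonglongrightarrow> 1"
  proof (rule tendsto_sandwich[of "\<lambda>_. 1" _ _ "\<lambda>n. 1 + real m / real n"])
    show "\<forall>\<^sub>F n in sequentially. 1 \<le> real (N n) / (real n / real m)"
      using eventually_gt_at_top[of 0]
    proof eventually_elim
      case (elim n)
      have "n \<le> N n * m" using m1 dividend_less_times_div[of m n] by (simp add: N_def mult.commute)
      then have "real n \<le> real (N n) * real m" by (simp flip: of_nat_mult)
      then show ?case using elim by simp
    qed
    show "\<forall>\<^sub>F n in sequentially. real (N n) / (real n / real m) \<le> 1 + real m / real n"
      using eventually_gt_at_top[of 0]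
    proof eventually_elim
      case (elim n)
      have "N n * m \<le> n + m" using times_div_less_eq_dividend[of m n] by (simp add: N_def algebra_simps)
      then have "real (N n) * real m \<le> real n + real m" by (simp flip: of_nat_mult of_nat_add)
      then show ?case using elim by (simp add: divide_simps)
    qed
    have "(\<lambda>n. 1 + real m / real n) \<longlonglongrightarrow> 1 + 0"
      by (intro tendsto_add tendsto_const lim_const_over_n)
    then show "(\<lambda>n. 1 + real m / real n) \<longlonglongrightarrow> 1" by simp
  qed simp
  have "(\<lambda>n. (\<Sum>i<N n. of_bool (occurs b t (m * i))) / real (N n) * (real (N n) / (real n / real m)))
      \<longlonglongrightarrow> gauss_length t * 1"
    by (intro tendsto_mult ratio filterlim_compose[OF prog N_lim])
  \<comment> \<open>\<open>N n\<close> is positive and cancels; at n = 0 both sides are 0 because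
    division by zero yields 0.\<close>
  moreover have "(\<Sum>i<N n. of_bool (occurs b t (m * i))) / real (N n) * (real (N n) / (real n / real m))
      = real (card {i. real i \<le> real n / real m \<and> (gauss_map ^^ (m * i)) x \<in> cylinder t}) / (real n / real m)" for n
    unfolding le_iff cyl count by (simp add: N_def)
  ultimately show "(\<lambda>n. real (card {i. real i \<le> real n / real m \<and> (gauss_map ^^ (m * i)) x \<in> cylinder t})
          / (real n / real m)) \<longlonglongrightarrow> measure gauss_measure (cylinder t)"
    by (simp only: measure_cylinder[OF t(2)] mult_1_right)
qed

end
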